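(* Let $G$ be a simple graph of order $n\geq 6$ that does not contain $\theta(1,2,2)$ as a subgraph. Then $q(G)\leq q(F_{n})$, with equality if and only if $G\cong F_{n}$.
   Context: All graphs are finite and simple. For a graph $G$, $Q(G)=D(G)+A(G)$ is its signless Laplacian matrix, where $D(G)$ is the diagonal matrix of vertex degrees and $A(G)$ the adjacency matrix; $q(G)$ denotes the largest eigenvalue of $Q(G)$ (the signless Laplacian spectral radius). The theta graph $\theta(l_{1},l_{2},l_{3})$ consists of two vertices joined by three internally vertex-disjoint paths of lengths $l_{1},l_{2},l_{3}$; thus $\theta(1,2,2)$ is $K_4$ minus an edge. A graph is $H$-free if it contains no subgraph isomorphic to $H$. The friendship-type graph $F_{n}$ is defined as follows: for odd $n\geq 3$, $F_n$ consists of $\frac{n-1}{2}$ triangles sharing exactly one common vertex (the center); for even $n\geq 4$, $F_n$ is obtained from $F_{n-1}$ by attaching a pendant edge to its center. *)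

theory Defs
  imports
    "Graph_Theory.Graph_Theory"
    "Jordan_Normal_Form.Spectral_Radius"
begin

text \<open>
  A finite simple graph is a \<^locale>\<open>pair_graph\<close>: finitely many vertices and a finite, symmetric,
  irreflexive set of arcs on them, so that an edge is a pair of opposite arcs.
\<close>

text \<open>
  The matrices of a graph are indexed by \<open>0, \<dots>, n - 1\<close> through an arbitrary but fixed
  enumeration of the vertices.  Another enumeration conjugates them by a permutation matrix and hence
  leaves the eigenvalues unchanged (see \<open>eigenvalue_signless_laplacian_iff\<close> below).
\<close>

definition vertex_list :: "'a pair_pre_digraph \<Rightarrow> 'a list" where
  "vertex_list G = (SOME xs. distinct xs \<and> set xs = pverts G)"

definition adjacency_mat :: "'a pair_pre_digraph \<Rightarrow> real mat" where
  "adjacency_mat G = (let xs = vertex_list G; n = card (pverts G) in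
     mat n n (\<lambda>(i, j). if (xs ! i, xs ! j) \<in> parcs G then 1 else 0))"

definition degree_mat :: "'a pair_pre_digraph \<Rightarrow> real mat" where
  "degree_mat G = (let xs = vertex_list G; n = card (pverts G) in
     mat n n (\<lambda>(i, j). if i = j then real (out_degree (with_proj G) (xs ! i)) else 0))"

definition signless_laplacian :: "'a pair_pre_digraph \<Rightarrow> real mat" where
  "signless_laplacian G = degree_mat G + adjacency_mat G"

text \<open>The signless Laplacian is a real symmetric matrix, so its spectrum over the reals is all of it.\<close>

definition signless_spectral_radius :: "'a pair_pre_digraph \<Rightarrow> real" where
  "signless_spectral_radius G = Max (spectrum (signless_laplacian G))"

text \<open>
  The theta graphs, as a property of \<open>H\<close> that is invariant under isomorphism.  The three paths are
  required to be distinct, as internal disjointness alone does not exclude that two paths of length 1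
  coincide.
\<close>

definition theta_graph :: "nat \<Rightarrow> nat \<Rightarrow> nat \<Rightarrow> 'a pair_pre_digraph \<Rightarrow> bool" where
  "theta_graph l1 l2 l3 H \<longleftrightarrow> pair_graph H \<and>
     (\<exists>u v p1 p2 p3. u \<noteq> v \<and>
        pre_digraph.apath (with_proj H) u p1 v \<and> length p1 = l1 \<and>
        pre_digraph.apath (with_proj H) u p2 v \<and> length p2 = l2 \<and>
        pre_digraph.apath (with_proj H) u p3 v \<and> length p3 = l3 \<and>
        distinct [p1, p2, p3] \<and>
        set (pre_digraph.inner_verts (with_proj H) p1) \<inter> set (pre_digraph.inner_verts (with_proj H) p2) = {} \<and>
        set (pre_digraph.inner_verts (with_proj H) p1) \<inter> set (pre_digraph.inner_verts (with_proj H) p3) = {} \<and>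
        set (pre_digraph.inner_verts (with_proj H) p2) \<inter> set (pre_digraph.inner_verts (with_proj H) p3) = {} \<and>
        pverts H = set (pawalk_verts u p1) \<union> set (pawalk_verts u p2) \<union> set (pawalk_verts u p3) \<and>
        parcs H = (set p1 \<union> set p2 \<union> set p3) \<union> (set p1 \<union> set p2 \<union> set p3)\<inverse>)"

definition theta_free :: "nat \<Rightarrow> nat \<Rightarrow> nat \<Rightarrow> 'a pair_pre_digraph \<Rightarrow> bool" where
  "theta_free l1 l2 l3 G \<longleftrightarrow>
     \<not> (\<exists>H. subgraph (with_proj H) (with_proj G) \<and> theta_graph l1 l2 l3 H)"

text \<open>The \<open>k\<close> triangles \<open>{0, 2i - 1, 2i}\<close>, \<open>1 \<le> i \<le> k\<close>, with common center \<open>0\<close>.\<close>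

definition triangles :: "nat \<Rightarrow> nat pair_pre_digraph" where
  "triangles k = \<lparr> pverts = {0..2 * k},
     parcs = (\<Union>i\<in>{1..k}. {(u, v). u \<in> {0, 2 * i - 1, 2 * i} \<and> v \<in> {0, 2 * i - 1, 2 * i} \<and> u \<noteq> v}) \<rparr>"

text \<open>
  For even \<open>n\<close> the graph \<open>triangles ((n - 2) div 2)\<close> is \<open>F\<^bsub>n - 1\<^esub>\<close> on the vertices
  \<open>0, \<dots>, n - 2\<close>, and \<open>n - 1\<close> is the new pendant vertex.  Only \<open>n \<ge> 3\<close> is meaningful.
\<close>

definition friendship :: "nat \<Rightarrow> nat pair_pre_digraph" where
  "friendship n =
     (if odd n then triangles ((n - 1) div 2)
      else let F = triangles ((n - 2) div 2) in
        \<lparr> pverts = insert (n - 1) (pverts F), parcs = parcs F \<union> {(0, n - 1), (n - 1, 0)} \<rparr>)"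

lemma vertex_list:
  assumes "finite (pverts G)"
  shows "distinct (vertex_list G)" "set (vertex_list G) = pverts G"
proof -
  have "\<exists>xs. distinct xs \<and> set xs = pverts G"
    using finite_distinct_list[OF assms] by blast
  then have "distinct (vertex_list G) \<and> set (vertex_list G) = pverts G"
    unfolding vertex_list_def by (rule someI_ex)
  then show "distinct (vertex_list G)" "set (vertex_list G) = pverts G" by auto
qed

lemma eigenvalue_signless_laplacian_iff:
  assumes "pair_graph G"
  shows "eigenvalue (signless_laplacian G) k \<longleftrightarrow>
    (\<exists>x. (\<exists>v\<in>pverts G. x v \<noteq> 0) \<and>
      (\<forall>v\<in>pverts G. real (out_degree (with_proj G) v) * x v + (\<Sum>w | (v, w) \<in> parcs G. x w) = k * x v))"
proof -
  interpret pair_graph G by fact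
  let ?xs = "vertex_list G" and ?n = "card (pverts G)" and ?V = "pverts G"
  note fin = pair_finite_verts
  note xs = vertex_list[OF fin]
  have len: "length ?xs = ?n" using distinct_card[OF xs(1)] xs(2) by simp
  have bij: "bij_betw (\<lambda>i. ?xs ! i) {0..<?n} ?V"
    by (rule bij_betw_nth[OF xs(1)]) (simp_all add: xs(2) len atLeast0LessThan)
  have dim: "signless_laplacian G \<in> carrier_mat ?n ?n"
    by (simp add: signless_laplacian_def degree_mat_def adjacency_mat_def Let_def)
  have mv: "(signless_laplacian G *\<^sub>v vec ?n (\<lambda>i. x (?xs ! i))) $ i =
     real (out_degree (with_proj G) (?xs ! i)) * x (?xs ! i) + (\<Sum>w | (?xs ! i, w) \<in> parcs G. x w)"
    if i: "i < ?n" for x :: "_ \<Rightarrow> real" and i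
  proof -
    have "(signless_laplacian G *\<^sub>v vec ?n (\<lambda>i. x (?xs ! i))) $ i =
      (\<Sum>j\<in>{0..<?n}. ((if i = j then real (out_degree (with_proj G) (?xs ! i)) else 0)
         + (if (?xs ! i, ?xs ! j) \<in> parcs G then 1 else 0)) * x (?xs ! j))"
      using i by (simp add: scalar_prod_def signless_laplacian_def degree_mat_def adjacency_mat_def Let_def)
    also have "\<dots> = (\<Sum>j\<in>{0..<?n}. (if i = j then real (out_degree (with_proj G) (?xs ! i)) * x (?xs ! j) else 0))
        + (\<Sum>j\<in>{0..<?n}. if (?xs ! i, ?xs ! j) \<in> parcs G then x (?xs ! j) else 0)"
      by (subst sum.distrib[symmetric], rule sum.cong) (auto simp: algebra_simps)
    also have "(\<Sum>j\<in>{0..<?n}. (if i = j then real (out_degree (with_proj G) (?xs ! i)) * x (?xs ! j) else 0))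
       = real (out_degree (with_proj G) (?xs ! i)) * x (?xs ! i)"
      using i by (simp add: sum.delta)
    also have "(\<Sum>j\<in>{0..<?n}. if (?xs ! i, ?xs ! j) \<in> parcs G then x (?xs ! j) else 0)
       = (\<Sum>w\<in>?V. if (?xs ! i, w) \<in> parcs G then x w else 0)"
      by (rule sum.reindex_bij_betw[OF bij])
    also have "\<dots> = (\<Sum>w | w \<in> ?V \<and> (?xs ! i, w) \<in> parcs G. x w)"
      using fin by (simp add: sum.If_cases Int_def)
    also have "{w. w \<in> ?V \<and> (?xs ! i, w) \<in> parcs G} = {w. (?xs ! i, w) \<in> parcs G}"
      using in_arcsD2 by auto
    finally show ?thesis .
  qed
  have all: "(\<forall>v\<in>?V. P v) \<longleftrightarrow> (\<forall>i<?n. P (?xs ! i))" for P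
    using all_set_conv_all_nth[of ?xs P] xs(2) len by simp
  have main: "eigenvector (signless_laplacian G) (vec ?n (\<lambda>i. x (?xs ! i))) k \<longleftrightarrow>
      (\<exists>v\<in>?V. x v \<noteq> 0) \<and>
      (\<forall>v\<in>?V. real (out_degree (with_proj G) v) * x v + (\<Sum>w | (v, w) \<in> parcs G. x w) = k * x v)"
    (is "?L \<longleftrightarrow> ?R") for x
  proof -
    have "vec ?n (\<lambda>i. x (?xs ! i)) = 0\<^sub>v ?n \<longleftrightarrow> (\<forall>v\<in>?V. x v = 0)"
      unfolding all by (auto simp: vec_eq_iff)
    moreover have "signless_laplacian G *\<^sub>v vec ?n (\<lambda>i. x (?xs ! i)) = k \<cdot>\<^sub>v vec ?n (\<lambda>i. x (?xs ! i)) \<longleftrightarrow>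
      (\<forall>v\<in>?V. real (out_degree (with_proj G) v) * x v + (\<Sum>w | (v, w) \<in> parcs G. x w) = k * x v)"
      unfolding all using dim mv by (auto simp: vec_eq_iff simp del: index_mult_mat_vec)
    ultimately show ?thesis
      using dim unfolding eigenvector_def by auto
  qed
  show ?thesis
  proof
    assume "eigenvalue (signless_laplacian G) k"
    then obtain y where y: "eigenvector (signless_laplacian G) y k"
      unfolding eigenvalue_def by blast
    define x where "x v = y $ (the_inv_into {0..<?n} (\<lambda>i. ?xs ! i) v)" for v
    have "x (?xs ! i) = y $ i" if "i < ?n" for i
      using that bij by (simp add: x_def bij_betw_def the_inv_into_f_f)
    moreover have "dim_vec y = ?n" using y dim by (auto simp: eigenvector_def)
    ultimately have "vec ?n (\<lambda>i. x (?xs ! i)) = y" by (auto simp: vec_eq_iff)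
    with y main[of x] show "\<exists>x. (\<exists>v\<in>?V. x v \<noteq> 0) \<and>
      (\<forall>v\<in>?V. real (out_degree (with_proj G) v) * x v + (\<Sum>w | (v, w) \<in> parcs G. x w) = k * x v)"
      by auto
  next
    assume "\<exists>x. (\<exists>v\<in>?V. x v \<noteq> 0) \<and>
      (\<forall>v\<in>?V. real (out_degree (with_proj G) v) * x v + (\<Sum>w | (v, w) \<in> parcs G. x w) = k * x v)"
    then show "eigenvalue (signless_laplacian G) k"
      unfolding eigenvalue_def using main by blast
  qed
qed

lemma pair_graph_triangles: "pair_graph (triangles k)"
proof unfold_locales
  have verts: "pverts (triangles k) = {0..2 * k}" by (simp add: triangles_def)
  have arcs: "(u, v) \<in> parcs (triangles k) \<longleftrightarrow>
      (\<exists>i\<in>{1..k}. u \<in> {0, 2 * i - 1, 2 * i} \<and> v \<in> {0, 2 * i - 1, 2 * i} \<and> u \<noteq> v)" for u v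
    unfolding triangles_def by simp
  have sub: "parcs (triangles k) \<subseteq> {0..2 * k} \<times> {0..2 * k}"
    by (rule subrelI) (auto simp only: arcs atLeastAtMost_iff mem_Times_iff fst_conv snd_conv insert_iff empty_iff)
  show "finite (parcs (triangles k))" by (rule finite_subset[OF sub]) simp
  show "fst e \<in> pverts (triangles k)" "snd e \<in> pverts (triangles k)" if "e \<in> parcs (triangles k)" for e
    using subsetD[OF sub that] unfolding verts mem_Times_iff by blast+
  show "symmetric (with_proj (triangles k))"
    unfolding symmetric_def with_proj_simps by (rule symI) (unfold arcs, metis)
  show "fst e \<noteq> snd e" if "e \<in> parcs (triangles k)" for e
    using that by (cases e) (simp only: arcs fst_conv snd_conv, blast)
  show "finite (pverts (triangles k))" by (simp add: verts)
qed

lemma pair_graph_friendship: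
  assumes "n \<ge> 3"
  shows "pair_graph (friendship n)"
proof (cases "odd n")
  case True
  then show ?thesis by (simp add: friendship_def pair_graph_triangles)
next
  case False
  define F where "F = triangles ((n - 2) div 2)"
  interpret F: pair_graph F unfolding F_def by (rule pair_graph_triangles)
  have F: "friendship n = \<lparr> pverts = insert (n - 1) (pverts F), parcs = parcs F \<union> {(0, n - 1), (n - 1, 0)} \<rparr>"
    using False by (simp add: friendship_def F_def Let_def)
  have 0: "0 \<in> pverts F" by (simp add: F_def triangles_def)
  have "sym (parcs F)" using F.pair_sym_arcs by (simp add: symmetric_def)
  then show ?thesis
    using assms 0 F.pair_finite_verts F.pair_finite_arcs F.pair_no_loops
    unfolding F by unfold_locales (auto simp: symmetric_def sym_def dest: F.in_arcsD1 F.in_arcsD2)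
qed

lemma card_pverts_friendship:
  assumes "n \<ge> 3"
  shows "card (pverts (friendship n)) = n"
proof (cases "odd n")
  case True
  then have "2 * ((n - 1) div 2) = n - 1" by simp
  with True assms show ?thesis by (simp add: friendship_def triangles_def)
next
  case False
  then have "2 * ((n - 2) div 2) = n - 2" by simp
  with False assms show ?thesis by (simp add: friendship_def triangles_def)
qed

lemma theta_graph_1_2_2_iff:
  "theta_graph 1 2 2 H \<longleftrightarrow>
    (\<exists>u v a b. distinct [u, v, a, b] \<and> pverts H = {u, v, a, b} \<and>
      parcs H = {u, v, a, b} \<times> {u, v, a, b} - Id - {(a, b), (b, a)})"
    (is "?L \<longleftrightarrow> ?R")
proof
  assume L: ?L
  then interpret pair_graph H by (simp add: theta_graph_def)
  from L obtain u v p1 p2 p3 where H: "u \<noteq> v" "apath u p1 v" "length p1 = 1"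
      "apath u p2 v" "length p2 = 2" "apath u p3 v" "length p3 = 2"
      "set (inner_verts p2) \<inter> set (inner_verts p3) = {}"
      "pverts H = set (pawalk_verts u p1) \<union> set (pawalk_verts u p2) \<union> set (pawalk_verts u p3)"
      "parcs H = (set p1 \<union> set p2 \<union> set p3) \<union> (set p1 \<union> set p2 \<union> set p3)\<inverse>"
    unfolding theta_graph_def by blast
  have p1: "p1 = [(u, v)]"
    using H(2,3) by (cases p1) (auto simp: apath_def awalk_def)
  have two: "\<exists>a. p = [(u, a), (a, v)] \<and> distinct [u, v, a]" if "apath u p v" "length p = 2" for p
    using that by (auto simp: apath_def awalk_def numeral_2_eq_2 length_Suc_conv)
  obtain a where a: "p2 = [(u, a), (a, v)]" "distinct [u, v, a]" using two H(4,5) by blast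
  obtain b where b: "p3 = [(u, b), (b, v)]" "distinct [u, v, b]" using two H(6,7) by blast
  have "a \<noteq> b" using H(8) a b by (auto simp: inner_verts_def)
  then have "distinct [u, v, a, b]" using a b by auto
  moreover have "pverts H = {u, v, a, b}" using H(9) p1 a b by auto
  moreover have "parcs H = {u, v, a, b} \<times> {u, v, a, b} - Id - {(a, b), (b, a)}"
    using H(10) p1 a b \<open>a \<noteq> b\<close> by auto
  ultimately show ?R by blast
next
  assume ?R
  then obtain u v a b where R: "distinct [u, v, a, b]" "pverts H = {u, v, a, b}"
    "parcs H = {u, v, a, b} \<times> {u, v, a, b} - Id - {(a, b), (b, a)}" by (elim exE conjE)
  interpret pair_graph H
  proof unfold_locales
    have sub: "parcs H \<subseteq> pverts H \<times> pverts H - Id" unfolding R(2,3) by (rule Diff_subset)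
    show "finite (pverts H)" by (simp add: R(2))
    then show "finite (parcs H)" using finite_subset[OF sub] by simp
    show "symmetric (with_proj H)"
      unfolding symmetric_def with_proj_simps R(3) by (rule symI) blast
    show "fst e \<noteq> snd e" "fst e \<in> pverts H" "snd e \<in> pverts H" if "e \<in> parcs H" for e
      using subsetD[OF sub that] by (cases e, simp)+
  qed
  let ?p1 = "[(u, v)]" and ?p2 = "[(u, a), (a, v)]" and ?p3 = "[(u, b), (b, v)]"
  have "u \<noteq> v" using R(1) by simp
  moreover have "apath u ?p1 v" "apath u ?p2 v" "apath u ?p3 v"
    using R(1) by (auto simp: apath_def awalk_def R(2,3))
  moreover have "distinct [?p1, ?p2, ?p3]" using R(1) by auto
  moreover have "set (inner_verts ?p1) \<inter> set (inner_verts ?p2) = {}"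
    "set (inner_verts ?p1) \<inter> set (inner_verts ?p3) = {}"
    "set (inner_verts ?p2) \<inter> set (inner_verts ?p3) = {}"
    using R(1) by (auto simp: inner_verts_def)
  moreover have "pverts H = set (pawalk_verts u ?p1) \<union> set (pawalk_verts u ?p2) \<union> set (pawalk_verts u ?p3)"
    using R(2) by auto
  moreover have "parcs H = (set ?p1 \<union> set ?p2 \<union> set ?p3) \<union> (set ?p1 \<union> set ?p2 \<union> set ?p3)\<inverse>"
    using R(1) unfolding R(3) by auto
  moreover have "length ?p1 = 1" "length ?p2 = 2" "length ?p3 = 2" by auto
  ultimately show ?L
    unfolding theta_graph_def using pair_graph_axioms by blast
qed

end

theory Submission
  imports Defs
begin

text \<open>
  If \<open>y > 0\<close> satisfies \<open>Q y \<le> c y\<close> entrywise, then \<open>q(G) \<le> c\<close>.  When all degrees are at most \<open>n - 3\<close>,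
  the degree vector gives \<open>q(G) \<le> n\<close>: in a diamond-free graph the neighbourhood of \<open>v\<close> induces a
  matching, and any other vertex is adjacent to at most one end of each matching edge.  When some
  vertex has degree \<open>n - 2\<close>, an explicit vector taking five values gives \<open>q(G) \<le> n\<close> again.  When
  \<open>v\<close> has degree \<open>n - 1\<close>, the eigenvalues \<open>k > 3\<close> are the solutions of \<open>k (k - n) (k - 3) = 2 m\<close>, where
  \<open>m\<close> is the (even) number of neighbours of \<open>v\<close> covered by the matching.  The left-hand side increases for \<open>k \<ge> n\<close>,
  so \<open>q(G)\<close> is largest exactly when \<open>m\<close> is, that is, for \<open>F\<^sub>n\<close>, and \<open>q(F\<^sub>n) > n\<close>.
\<close>

section \<open>Eigenvalues of real symmetric matrices\<close>

text \<open>Over the complex numbers an eigenvalue exists, and for a symmetric real matrix the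
  Hermitian form of an eigenvector equals its own conjugate, so this eigenvalue is real. Hence the
  \<open>Max\<close> defining the spectral radius ranges over a nonempty set.\<close>

lemma symmetric_real_mat_eigenvalue:
  fixes A :: "real mat"
  assumes A: "A \<in> carrier_mat n n" and sym: "\<And>i j. i < n \<Longrightarrow> j < n \<Longrightarrow> A $$ (i, j) = A $$ (j, i)" and "n > 0"
  shows "\<exists>k. eigenvalue A k"
proof -
  let ?B = "map_mat complex_of_real A"
  have B: "?B \<in> carrier_mat n n" using A by simp
  obtain c where c: "eigenvalue ?B c"
    using spectrum_non_empty[OF B \<open>n > 0\<close>] by (auto simp: spectrum_def)
  then obtain z where z: "z \<in> carrier_vec n" "z \<noteq> 0\<^sub>v n" "?B *\<^sub>v z = c \<cdot>\<^sub>v z"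
    using B by (auto simp: eigenvalue_def eigenvector_def)
  have row: "(\<Sum>j<n. of_real (A $$ (i, j)) * z $ j) = c * z $ i" if "i < n" for i
  proof -
    have "(?B *\<^sub>v z) $ i = (\<Sum>j<n. of_real (A $$ (i, j)) * z $ j)"
      using that A z(1) by (auto simp: scalar_prod_def atLeast0LessThan intro!: sum.cong)
    with z(1,3) that show ?thesis by simp
  qed
  \<comment> \<open>\<open>S\<close> is the Hermitian form of \<open>z\<close> and \<open>R\<close>
    its squared norm; the eigenvector equation gives \<open>S = c * of_real R\<close>.\<close>
  define S where "S = (\<Sum>i<n. \<Sum>j<n. of_real (A $$ (i, j)) * cnj (z $ i) * z $ j)"
  define R where "R = (\<Sum>i<n. (cmod (z $ i))\<^sup>2)"
  have "S = (\<Sum>i<n. cnj (z $ i) * (\<Sum>j<n. of_real (A $$ (i, j)) * z $ j))"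
    unfolding S_def sum_distrib_left by (intro sum.cong refl) (simp add: mult_ac)
  also have "\<dots> = (\<Sum>i<n. c * of_real ((cmod (z $ i))\<^sup>2))"
    by (intro sum.cong refl, subst row) (simp_all add: complex_norm_square mult_ac del: of_real_power)
  finally have S: "S = c * of_real R" by (simp add: R_def sum_distrib_left)
  have "cnj S = (\<Sum>i<n. \<Sum>j<n. of_real (A $$ (i, j)) * z $ i * cnj (z $ j))"
    by (simp add: S_def)
  also have "\<dots> = (\<Sum>j<n. \<Sum>i<n. of_real (A $$ (i, j)) * z $ i * cnj (z $ j))"
    by (rule sum.swap)
  also have "\<dots> = S"
    unfolding S_def by (intro sum.cong refl) (simp add: sym mult_ac)
  finally have "cnj c * of_real R = c * of_real R" using S by simp
  moreover have "R \<noteq> 0"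
  proof
    assume "R = 0"
    then have "\<forall>i<n. z $ i = 0" by (simp add: R_def sum_nonneg_eq_0_iff)
    with z(1,2) show False by (auto simp: vec_eq_iff)
  qed
  ultimately have "cnj c = c" by simp
  then obtain k where k: "c = complex_of_real k" by (metis Reals_cnj_iff Reals_cases)
  \<comment> \<open>The characteristic polynomial brings the real root back to \<open>A\<close>, so
    no real eigenvector has to be extracted from \<open>z\<close>.\<close>
  have "poly (char_poly ?B) c = 0" using c eigenvalue_root_char_poly[OF B] by blast
  then have "poly (char_poly A) k = 0"
    by (simp add: k of_real_hom.char_poly_hom[OF A])
  then show ?thesis using eigenvalue_root_char_poly[OF A] by blast
qed

section \<open>The signless Laplacian spectral radius\<close>

definition nbrs :: "'a pair_pre_digraph \<Rightarrow> 'a \<Rightarrow> 'a set" where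
  "nbrs G v = {w. (v, w) \<in> parcs G}"

lemma eigenvalue_iff_nbrs:
  assumes "pair_graph G"
  shows "eigenvalue (signless_laplacian G) k \<longleftrightarrow>
    (\<exists>x. (\<exists>v\<in>pverts G. x v \<noteq> 0) \<and>
      (\<forall>v\<in>pverts G. real (card (nbrs G v)) * x v + sum x (nbrs G v) = k * x v))"
proof -
  have "out_degree (with_proj G) v = card (nbrs G v)" for v
  proof -
    have "out_arcs (with_proj G) v = Pair v ` nbrs G v"
      by (auto simp: out_arcs_def nbrs_def)
    then show ?thesis by (simp add: out_degree_def card_image inj_on_def)
  qed
  then show ?thesis
    using eigenvalue_signless_laplacian_iff[OF assms, of k] by (simp add: nbrs_def)
qed

context pair_graph
begin

lemma nbrs_sym: "w \<in> nbrs G v \<Longrightarrow> v \<in> nbrs G w"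
  using pair_sym_arcs by (auto simp: nbrs_def symmetric_def sym_def)

lemma nbrs_verts: "w \<in> nbrs G v \<Longrightarrow> w \<in> pverts G" "w \<in> nbrs G v \<Longrightarrow> v \<in> pverts G"
  by (auto simp: nbrs_def dest: in_arcsD1 in_arcsD2)

lemma nbrs_irrefl: "v \<notin> nbrs G v"
  using pair_no_loops[of "(v, v)"] by (auto simp: nbrs_def)

lemma finite_nbrs [simp]: "finite (nbrs G v)"
  by (rule finite_subset[OF _ pair_finite_verts]) (auto dest: nbrs_verts)

lemma card_nbrs_less: "v \<in> pverts G \<Longrightarrow> card (nbrs G v) < card (pverts G)"
  using nbrs_irrefl nbrs_verts(1) by (intro psubset_card_mono) auto

lemma signless_laplacian_carrier:
  "signless_laplacian G \<in> carrier_mat (card (pverts G)) (card (pverts G))"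
  by (simp add: signless_laplacian_def degree_mat_def adjacency_mat_def Let_def)

lemma signless_spectral_radius_ge:
  "eigenvalue (signless_laplacian G) k \<Longrightarrow> k \<le> signless_spectral_radius G"
  unfolding signless_spectral_radius_def
  by (rule Max_ge) (auto simp: spectrum_def intro: card_finite_spectrum(1)[OF signless_laplacian_carrier, unfolded spectrum_def])

lemma eigenvalue_signless_spectral_radius:
  assumes "pverts G \<noteq> {}"
  shows "eigenvalue (signless_laplacian G) (signless_spectral_radius G)"
proof -
  let ?n = "card (pverts G)"
  have arc_sym: "(u, v) \<in> parcs G \<longleftrightarrow> (v, u) \<in> parcs G" for u v
    using nbrs_sym unfolding nbrs_def by blast
  have "?n > 0" using assms by (simp add: card_gt_0_iff)
  have "\<exists>k. eigenvalue (signless_laplacian G) k"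
    by (rule symmetric_real_mat_eigenvalue[OF signless_laplacian_carrier _ \<open>?n > 0\<close>])
      (auto simp: signless_laplacian_def degree_mat_def adjacency_mat_def Let_def arc_sym)
  then have "spectrum (signless_laplacian G) \<noteq> {}" by (auto simp: spectrum_def)
  then have "signless_spectral_radius G \<in> spectrum (signless_laplacian G)"
    unfolding signless_spectral_radius_def
    by (intro Max_in card_finite_spectrum(1)[OF signless_laplacian_carrier])
  then show ?thesis by (simp add: spectrum_def)
qed

text \<open>A Collatz-Wielandt bound for every eigenvalue, without a Perron vector: at a vertex
  where \<open>\<bar>x v\<bar> / y v\<close> is maximal, the eigenvector equation and the triangle
  inequality compare \<open>k * \<bar>x v\<bar>\<close> with the maximal ratio times the row of
  \<open>y\<close>.\<close>

lemma eigenvalue_le_test_function: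
  assumes "eigenvalue (signless_laplacian G) k"
    and pos: "\<And>v. v \<in> pverts G \<Longrightarrow> 0 < y v"
    and le: "\<And>v. v \<in> pverts G \<Longrightarrow> real (card (nbrs G v)) * y v + sum y (nbrs G v) \<le> c * y v"
  shows "k \<le> c"
proof -
  obtain x u where u: "u \<in> pverts G" "x u \<noteq> 0"
    and eq: "\<And>v. v \<in> pverts G \<Longrightarrow> real (card (nbrs G v)) * x v + sum x (nbrs G v) = k * x v"
    using assms(1) eigenvalue_iff_nbrs[OF pair_graph] by blast
  define r where "r = Max ((\<lambda>v. \<bar>x v\<bar> / y v) ` pverts G)"
  have "r \<in> (\<lambda>v. \<bar>x v\<bar> / y v) ` pverts G"
    unfolding r_def using u by (intro Max_in) auto
  then obtain v where v: "v \<in> pverts G" "r = \<bar>x v\<bar> / y v" by blast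
  have bound: "\<bar>x w\<bar> \<le> r * y w" if "w \<in> pverts G" for w
  proof -
    have "\<bar>x w\<bar> / y w \<le> r" unfolding r_def using that by (intro Max_ge) auto
    then show ?thesis using pos[OF that] by (simp add: pos_divide_le_eq)
  qed
  have "0 < \<bar>x u\<bar> / y u" using u pos by simp
  also have "\<dots> \<le> r" using u by (simp add: bound pos pos_divide_le_eq)
  finally have "r > 0" .
  have xv: "\<bar>x v\<bar> = r * y v" using v pos[OF v(1)] by simp
  have "k * \<bar>x v\<bar> \<le> \<bar>k * x v\<bar>" by (simp add: abs_mult mult_right_mono)
  also have "\<dots> = \<bar>real (card (nbrs G v)) * x v + sum x (nbrs G v)\<bar>" by (simp add: eq v(1))
  also have "\<dots> \<le> real (card (nbrs G v)) * \<bar>x v\<bar> + (\<Sum>w\<in>nbrs G v. \<bar>x w\<bar>)"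
    by (rule order_trans[OF abs_triangle_ineq]) (simp add: abs_mult add_mono sum_abs)
  also have "\<dots> \<le> real (card (nbrs G v)) * (r * y v) + (\<Sum>w\<in>nbrs G v. r * y w)"
    by (intro add_mono sum_mono) (auto simp: xv intro: bound nbrs_verts)
  also have "\<dots> = r * (real (card (nbrs G v)) * y v + sum y (nbrs G v))"
    by (simp add: algebra_simps sum_distrib_left)
  also have "\<dots> \<le> r * (c * y v)" using le[OF v(1)] \<open>r > 0\<close> by simp
  finally have "k * (r * y v) \<le> c * (r * y v)" using xv by (simp add: mult_ac)
  moreover have "r * y v > 0" using \<open>r > 0\<close> pos[OF v(1)] by simp
  ultimately show ?thesis by (rule mult_right_le_imp_le)
qed

text \<open>Both sides count the walks of length two from \<open>v\<close>, on the left by middle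
  vertex and on the right by end vertex.\<close>

lemma sum_card_nbrs:
  "(\<Sum>w\<in>nbrs G v. card (nbrs G w)) = (\<Sum>u\<in>pverts G. card (nbrs G u \<inter> nbrs G v))"
proof -
  have "(\<Sum>w\<in>nbrs G v. card (nbrs G w)) = (\<Sum>w\<in>nbrs G v. \<Sum>u\<in>pverts G. of_bool (u \<in> nbrs G w))"
    using nbrs_verts by (intro sum.cong refl) (auto simp: sum.If_cases of_bool_def intro!: arg_cong[of _ _ card])
  also have "\<dots> = (\<Sum>u\<in>pverts G. \<Sum>w\<in>nbrs G v. of_bool (u \<in> nbrs G w))"
    by (rule sum.swap)
  also have "\<dots> = (\<Sum>u\<in>pverts G. card (nbrs G u \<inter> nbrs G v))"
    using nbrs_sym by (intro sum.cong refl) (auto simp: sum.If_cases of_bool_def intro!: arg_cong[of _ _ card])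
  finally show ?thesis .
qed

end

section \<open>Neighbourhoods in diamond-free graphs\<close>

text \<open>The local form of \<theta>(1,2,2)-freeness: an edge \<open>uv\<close> lies in at most
  one triangle, since two common neighbours would be the degree-two vertices of a diamond.\<close>

locale diamond_free_graph = pair_graph +
  assumes common_nbr_unique:
    "\<lbrakk>v \<in> nbrs G u; a \<in> nbrs G u; a \<in> nbrs G v; b \<in> nbrs G u; b \<in> nbrs G v\<rbrakk> \<Longrightarrow> a = b"

lemma diamond_free_graphI:
  assumes "pair_graph G" "theta_free 1 2 2 G"
  shows "diamond_free_graph G"
proof -
  interpret pair_graph G by fact
  show ?thesis
  proof unfold_locales
    fix u v a b
    assume *: "v \<in> nbrs G u" "a \<in> nbrs G u" "a \<in> nbrs G v" "b \<in> nbrs G u" "b \<in> nbrs G v"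
    show "a = b"
    proof (rule ccontr)
      assume "a \<noteq> b"
      \<comment> \<open>The copy need not be induced: the arcs between \<open>a\<close> and
        \<open>b\<close> are left out whether or not \<open>G\<close> has them.\<close>
      define H where "H = \<lparr> pverts = {u, v, a, b}, parcs = {u, v, a, b} \<times> {u, v, a, b} - Id - {(a, b), (b, a)} \<rparr>"
      have d: "distinct [u, v, a, b]" using * \<open>a \<noteq> b\<close> nbrs_irrefl by auto
      have H: "theta_graph 1 2 2 H"
        unfolding theta_graph_1_2_2_iff using d by (intro exI[of _ u] exI[of _ v] exI[of _ a] exI[of _ b]) (simp add: H_def)
      then interpret H: pair_graph H by (simp add: theta_graph_def)
      have "subgraph (with_proj H) (with_proj G)"
        unfolding subgraph_def
      proof (intro conjI)
        show "verts (with_proj H) \<subseteq> verts (with_proj G)"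
          using * nbrs_verts by (auto simp: H_def)
        show "arcs (with_proj H) \<subseteq> arcs (with_proj G)"
          using *[THEN nbrs_sym] * by (auto simp: H_def nbrs_def)
        show "wf_digraph (with_proj G)" by unfold_locales
        show "wf_digraph (with_proj H)" by unfold_locales
        show "compatible (with_proj G) (with_proj H)" by (simp add: compatible_def)
      qed
      with H assms(2) show False by (auto simp: theta_free_def)
    qed
  qed
qed

context diamond_free_graph
begin

text \<open>A neighbour of \<open>v\<close> has at most one neighbour inside
  \<open>nbrs G v\<close>, so the neighbourhood induces a matching. These are the vertices that it
  covers.\<close>

definition matched :: "'a \<Rightarrow> 'a set" where
  "matched v = {w \<in> nbrs G v. nbrs G w \<inter> nbrs G v \<noteq> {}}"

text \<open>The other end of the matching edge at \<open>w\<close>; \<open>the_elem\<close> is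
  meaningful only for \<open>w\<close> in \<open>matched v\<close>, where the intersection is a
  singleton.\<close>

definition partner :: "'a \<Rightarrow> 'a \<Rightarrow> 'a" where
  "partner v w = the_elem (nbrs G w \<inter> nbrs G v)"

lemma matched_subset: "matched v \<subseteq> nbrs G v"
  by (auto simp: matched_def)

lemma finite_matched [simp]: "finite (matched v)"
  using matched_subset finite_nbrs by (rule finite_subset)

lemma nbrs_Int_matched:
  assumes "w \<in> matched v"
  shows "nbrs G w \<inter> nbrs G v = {partner v w}"
proof -
  obtain a where a: "a \<in> nbrs G w" "a \<in> nbrs G v" and w: "w \<in> nbrs G v"
    using assms by (auto simp: matched_def)
  then have "nbrs G w \<inter> nbrs G v = {a}" using common_nbr_unique by blast
  then show ?thesis by (simp add: partner_def)
qed

lemma partner_nbrs: "w \<in> matched v \<Longrightarrow> partner v w \<in> nbrs G w \<inter> nbrs G v"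
  using nbrs_Int_matched by blast

lemma partner_matched: "w \<in> matched v \<Longrightarrow> partner v w \<in> matched v"
  using partner_nbrs[of w v] nbrs_sym[of "partner v w" w] matched_subset[of v] by (auto simp: matched_def)

lemma partner_partner:
  assumes w: "w \<in> matched v"
  shows "partner v (partner v w) = w"
proof -
  have "w \<in> nbrs G (partner v w) \<inter> nbrs G v"
    using nbrs_sym[of "partner v w" w] partner_nbrs[OF w] subsetD[OF matched_subset w] by simp
  then show ?thesis using nbrs_Int_matched[OF partner_matched[OF w]] by simp
qed

lemma partner_neq: "w \<in> matched v \<Longrightarrow> partner v w \<noteq> w"
  using partner_nbrs[of w v] nbrs_irrefl[of w] by auto

lemma sum_card_nbrs_Int: "(\<Sum>u\<in>nbrs G v. card (nbrs G u \<inter> nbrs G v)) = card (matched v)"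
proof -
  have "(\<Sum>u\<in>nbrs G v. card (nbrs G u \<inter> nbrs G v)) = (\<Sum>u\<in>matched v. card (nbrs G u \<inter> nbrs G v))"
    by (rule sum.mono_neutral_right) (auto simp: matched_def)
  also have "\<dots> = (\<Sum>u\<in>matched v. 1)"
    by (rule sum.cong) (simp_all add: nbrs_Int_matched)
  finally show ?thesis by simp
qed

text \<open>A triangle at \<open>v\<close> whose other two vertices are adjacent to \<open>u\<close> as well spans a diamond.\<close>

lemma card_nbrs_matched:
  assumes "u \<noteq> v"
  shows "2 * card (nbrs G u \<inter> matched v) \<le> card (matched v)"
proof -
  have "partner v w \<notin> nbrs G u" if w: "w \<in> nbrs G u" "w \<in> matched v" for w
  proof
    assume "partner v w \<in> nbrs G u"
    then have "u = v"
      using common_nbr_unique[of "partner v w" w u v] w partner_nbrs[OF w(2)] matched_subset nbrs_sym by blast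
    with assms show False ..
  qed
  \<comment> \<open>\<open>partner v\<close> injects the matched vertices adjacent to
    \<open>u\<close> into those not adjacent to it, whence the factor two.\<close>
  then have "partner v ` (nbrs G u \<inter> matched v) \<subseteq> matched v - nbrs G u"
    using partner_matched by auto
  moreover have "inj_on (partner v) (nbrs G u \<inter> matched v)"
    by (rule inj_on_inverseI[of _ "partner v"]) (simp add: partner_partner)
  ultimately have "card (nbrs G u \<inter> matched v) \<le> card (matched v - nbrs G u)"
    by (metis card_image card_mono finite_Diff finite_matched)
  moreover have "card (matched v) = card (nbrs G u \<inter> matched v) + card (matched v - nbrs G u)"
    by (metis Diff_Diff_Int Int_commute card_Diff_subset_Int card_Int_Diff finite_Int finite_matched)
  ultimately show ?thesis by simp
qed

section \<open>Graphs without a dominating vertex\<close>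

text \<open>For the degree vector the neighbour sum at \<open>v\<close> counts walks of length two:
  \<open>d\<close> return to \<open>v\<close>, \<open>m\<close> end in its neighbourhood, and each
  of the \<open>n - 1 - d\<close> other vertices receives at most \<open>d - m / 2\<close>. Together
  with \<open>d * d\<close> this is at most
  \<open>n * d - m * ((n - 1 - d) / 2 - 1)\<close>.\<close>

lemma eigenvalue_le_small_degree:
  assumes k: "eigenvalue (signless_laplacian G) k"
    and deg: "\<And>v. v \<in> pverts G \<Longrightarrow> card (nbrs G v) + 3 \<le> card (pverts G)"
  shows "k \<le> card (pverts G)"
proof (rule eigenvalue_le_test_function[OF k])
  \<comment> \<open>The value 1 at isolated vertices only secures positivity; such a vertex enters
    no neighbour sum.\<close>
  define y where "y v = (if nbrs G v = {} then 1 else real (card (nbrs G v)))" for v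
  show "0 < y v" for v by (simp add: y_def card_gt_0_iff)
  fix v assume v: "v \<in> pverts G"
  define n where "n = card (pverts G)"
  define d where "d = card (nbrs G v)"
  define m where "m = card (matched v)"
  show "real (card (nbrs G v)) * y v + sum y (nbrs G v) \<le> card (pverts G) * y v"
  proof (cases "nbrs G v = {}")
    case True
    then show ?thesis by (simp add: y_def)
  next
    case False
    let ?R = "pverts G - insert v (nbrs G v)"
    have sub: "insert v (nbrs G v) \<subseteq> pverts G" using v nbrs_verts by blast
    have "card ?R = n - Suc d"
      using sub nbrs_irrefl by (simp add: card_Diff_subset n_def d_def)
    then have R: "real (card ?R) = real n - 1 - real d"
      using deg[OF v] by (simp add: n_def d_def)
    \<comment> \<open>All unmatched neighbours of \<open>v\<close> may be adjacent to
      \<open>u\<close>, but at most half of the matched ones.\<close>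
    have rest: "real (card (nbrs G u \<inter> nbrs G v)) \<le> real d - real m / 2" if "u \<in> ?R" for u
    proof -
      have "u \<noteq> v" using that by auto
      have "card (nbrs G u \<inter> nbrs G v) \<le> card ((nbrs G v - matched v) \<union> (nbrs G u \<inter> matched v))"
        by (rule card_mono) auto
      also have "\<dots> \<le> card (nbrs G v - matched v) + card (nbrs G u \<inter> matched v)"
        by (rule card_Un_le)
      also have "card (nbrs G v - matched v) = d - m"
        using matched_subset by (simp add: card_Diff_subset d_def m_def)
      finally have "card (nbrs G u \<inter> nbrs G v) \<le> d - m + card (nbrs G u \<inter> matched v)" .
      moreover have "2 * card (nbrs G u \<inter> matched v) \<le> m"
        using card_nbrs_matched[OF \<open>u \<noteq> v\<close>] by (simp add: m_def)
      moreover have "m \<le> d" unfolding m_def d_def by (rule card_mono) (simp_all add: matched_subset)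
      ultimately show ?thesis by linarith
    qed
    have "sum y (nbrs G v) = real (\<Sum>w\<in>nbrs G v. card (nbrs G w))"
      unfolding of_nat_sum using nbrs_sym by (intro sum.cong) (auto simp: y_def)
    also have "\<dots> = (\<Sum>u\<in>pverts G. real (card (nbrs G u \<inter> nbrs G v)))"
      by (simp add: sum_card_nbrs)
    also have "\<dots> = (\<Sum>u\<in>?R. real (card (nbrs G u \<inter> nbrs G v)))
        + (\<Sum>u\<in>insert v (nbrs G v). real (card (nbrs G u \<inter> nbrs G v)))"
      using sub by (intro sum.subset_diff) auto
    also have "(\<Sum>u\<in>insert v (nbrs G v). real (card (nbrs G u \<inter> nbrs G v))) = real d + real m"
      using sum_card_nbrs_Int[of v] nbrs_irrefl by (simp add: d_def m_def flip: of_nat_sum)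
    also have "(\<Sum>u\<in>?R. real (card (nbrs G u \<inter> nbrs G v))) \<le> (\<Sum>u\<in>?R. real d - real m / 2)"
      by (rule sum_mono) (rule rest)
    also have "\<dots> = (real n - 1 - real d) * (real d - real m / 2)" using R by simp
    also have "(real n - 1 - real d) * (real d - real m / 2)
        = (real n - 1 - real d) * real d - (real n - 1 - real d) * (real m / 2)"
      by (rule right_diff_distrib)
    finally have "sum y (nbrs G v) \<le>
        (real n - 1 - real d) * real d - (real n - 1 - real d) * (real m / 2) + (real d + real m)"
      by simp
    \<comment> \<open>The degree hypothesis enters as \<open>n - 1 - d \<ge> 2\<close>, which pays
      for the \<open>m\<close> walks ending in the neighbourhood.\<close>
    moreover have "2 * (real m / 2) \<le> (real n - 1 - real d) * (real m / 2)"
      using deg[OF v] by (intro mult_right_mono) (auto simp: n_def d_def)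
    moreover have "(real n - 1 - real d) * real d = real n * real d - real d - real d * real d"
      by (simp add: algebra_simps)
    ultimately have "real d * real d + sum y (nbrs G v) \<le> real n * real d" by linarith
    then show ?thesis using False by (simp add: y_def n_def d_def)
  qed
qed

text \<open>A single vertex \<open>z\<close> is not adjacent to \<open>v\<close>. The test
  inequality is checked on five classes: \<open>v\<close>, \<open>z\<close>, the unmatched
  neighbours of \<open>v\<close>, and the matched ones according to adjacency to
  \<open>z\<close>.\<close>

lemma eigenvalue_le_degree_minus_2:
  assumes k: "eigenvalue (signless_laplacian G) k"
    and v: "v \<in> pverts G" "card (nbrs G v) + 2 = card (pverts G)"
    and ge: "card (pverts G) \<ge> 6"
  shows "k \<le> card (pverts G)"
proof -
  define n where "n = card (pverts G)"
  define m where "m = card (matched v)"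
  have "card (pverts G - insert v (nbrs G v)) = 1"
    using v nbrs_irrefl nbrs_verts(1) by (subst card_Diff_subset) auto
  then obtain z where z: "pverts G - insert v (nbrs G v) = {z}" by (rule card_1_singletonE)
  then have V: "pverts G = insert v (insert z (nbrs G v))" and zv: "z \<noteq> v" "z \<notin> nbrs G v"
    using v nbrs_verts(1) by blast+
  \<comment> \<open>The sum \<open>y v + y z = 2 * n - 4\<close> makes the inequality tight at an
    unmatched vertex of degree two. Shifting \<open>m / 2\<close> from \<open>z\<close> to
    \<open>v\<close> makes room at \<open>v\<close> for the heavier matched vertices, and the value
    7/2 pays for degree three at those adjacent to \<open>z\<close>.\<close>
  define y where "y u = (if u = v then real n - 2 + real m / 2 else if u = z then real n - 2 - real m / 2
    else if u \<notin> matched v then 2 else if u \<in> nbrs G z then 7 / 2 else 5 / 2)" for u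
  have n6: "real n \<ge> 6" using ge by (simp add: n_def)
  have cN: "real (card (nbrs G v)) = real n - 2" using v(2) by (simp add: n_def)
  have "m \<le> card (nbrs G v)" unfolding m_def by (rule card_mono) (simp_all add: matched_subset)
  then have mn: "real m \<le> real n - 2" using cN by simp
  have pos: "0 < y u" for u using n6 mn by (auto simp: y_def)
  define a where "a = real (card (nbrs G z \<inter> matched v))"
  have a: "a \<le> real m / 2" using card_nbrs_matched[OF zv(1)] by (simp add: a_def m_def)
  have unm: "y u = 2" if "u \<in> nbrs G v - matched v" for u
    using that zv nbrs_irrefl by (auto simp: y_def)
  have mat: "y u = (if u \<in> nbrs G z then 7 / 2 else 5 / 2)" if "u \<in> matched v" for u
    using that zv nbrs_irrefl matched_subset[of v] by (auto simp: y_def)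
  have "real (card (nbrs G u)) * y u + sum y (nbrs G u) \<le> real n * y u" if "u \<in> pverts G" for u
  proof -
    have "nbrs G u \<subseteq> pverts G" by (auto dest: nbrs_verts(1))
    then have split: "nbrs G u = (nbrs G u \<inter> nbrs G v) \<union> (nbrs G u \<inter> {v, z})" unfolding V by blast
    consider "u = v" | "u = z" | "u \<in> nbrs G v - matched v"
      | "u \<in> matched v" "u \<in> nbrs G z" | "u \<in> matched v" "u \<notin> nbrs G z"
      using \<open>u \<in> pverts G\<close> unfolding V by blast
    then show ?thesis
    proof cases
      case 1
      \<comment> \<open>As \<open>v\<close> has degree \<open>n - 2\<close>, its neighbour sum must
        be at most \<open>2 * y v\<close>. The sum is \<open>2 * n - 4 + m / 2 + a\<close>, with
        \<open>a \<le> m / 2\<close>.\<close>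
      have "sum y (nbrs G v) = sum y (nbrs G v - matched v) + sum y (matched v)"
        using matched_subset by (intro sum.subset_diff) auto
      also have "sum y (nbrs G v - matched v) = 2 * (real n - 2 - real m)"
        using unm matched_subset \<open>m \<le> _\<close> by (simp add: card_Diff_subset of_nat_diff cN flip: m_def)
      also have "sum y (matched v) = (\<Sum>u\<in>matched v. 5 / 2 + of_bool (u \<in> nbrs G z))"
        by (rule sum.cong) (auto simp: mat)
      also have "\<dots> = 5 / 2 * real m + a"
        by (simp add: sum.distrib m_def a_def of_bool_def sum.If_cases Int_commute)
      finally have "sum y (nbrs G v) \<le> 2 * y v" using a by (simp add: y_def)
      then show ?thesis unfolding 1 cN by (simp add: algebra_simps)
    next
      case 2
      define b where "b = real (card (nbrs G z - matched v))"
      have sub: "nbrs G z \<subseteq> nbrs G v"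
        using split nbrs_irrefl[of z] nbrs_sym[of v z] zv unfolding 2 by auto
      have "card (nbrs G z - matched v) \<le> card (nbrs G v - matched v)"
        using sub by (intro card_mono) auto
      also have "card (nbrs G v - matched v) = card (nbrs G v) - m"
        using matched_subset by (simp add: card_Diff_subset m_def)
      finally have b: "b \<le> real n - 2 - real m"
        using cN \<open>m \<le> _\<close> unfolding b_def by linarith
      have "card (nbrs G z) = card (nbrs G z \<inter> matched v) + card (nbrs G z - matched v)"
        by (rule card_Int_Diff) simp
      then have cz: "real (card (nbrs G z)) = a + b" by (simp add: a_def b_def)
      have "sum y (nbrs G z) = sum y (nbrs G z - matched v) + sum y (nbrs G z \<inter> matched v)"
        by (metis add.commute finite_nbrs sum.Int_Diff)
      also have "sum y (nbrs G z - matched v) = (\<Sum>u\<in>nbrs G z - matched v. 2)"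
        using unm sub by (intro sum.cong) auto
      also have "\<dots> = 2 * b" by (simp add: b_def)
      also have "sum y (nbrs G z \<inter> matched v) = (\<Sum>u\<in>nbrs G z \<inter> matched v. 7 / 2)"
        using mat by (intro sum.cong) auto
      also have "\<dots> = 7 / 2 * a" by (simp add: a_def)
      finally have sz: "sum y (nbrs G z) = 2 * b + 7 / 2 * a" .
      \<comment> \<open>\<open>D\<close> also bounds the degree \<open>a + b\<close> of
        \<open>z\<close>. After writing \<open>n = D + 2 + m / 2\<close>, the slack
        \<open>m / 2 * D \<ge> m\<close> absorbs the excess \<open>3 / 4 * m\<close> caused by the
        values 7/2.\<close>
      define D where "D = real n - 2 - real m / 2"
      have yz: "y z = D" using zv by (simp add: y_def D_def)
      have D: "D \<ge> 2" using n6 mn by (simp add: D_def)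
      have "(a + b) * D \<le> D * D" using a b D by (intro mult_right_mono) (simp_all add: D_def)
      moreover have "2 * b + 7 / 2 * a \<le> 2 * D + 3 / 4 * real m" using a b by (simp add: D_def)
      moreover have "real m / 2 * D \<ge> real m / 2 * 2" using D by (intro mult_left_mono) auto
      moreover have "real n * D = D * D + 2 * D + real m / 2 * D" by (simp add: D_def algebra_simps)
      ultimately show ?thesis unfolding 2 cz sz yz by linarith
    next
      case 3
      have "nbrs G u \<inter> nbrs G v = {}" using 3 by (auto simp: matched_def)
      with split have sub: "nbrs G u \<subseteq> {v, z}" by auto
      have "card (nbrs G u) \<le> card {v, z}" by (rule card_mono) (use sub in auto)
      also have "\<dots> = 2" using zv by simp
      finally have "real (card (nbrs G u)) * 2 \<le> 4" by simp
      moreover have "sum y (nbrs G u) \<le> sum y {v, z}"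
        by (rule sum_mono2) (use sub pos in \<open>auto intro: less_imp_le\<close>)
      moreover have "sum y {v, z} = 2 * real n - 4" using zv by (simp add: y_def)
      ultimately show ?thesis using unm[OF 3] by simp
    next
      case 4
      let ?p = "partner v u"
      have p: "?p \<in> nbrs G u" "?p \<in> nbrs G v" using partner_nbrs[OF 4(1)] by auto
      have "u \<in> nbrs G v" using 4(1) matched_subset by blast
      then have uv: "v \<in> nbrs G u" by (rule nbrs_sym)
      have uz: "z \<in> nbrs G u" using 4(2) by (rule nbrs_sym)
      \<comment> \<open>Otherwise the edge between \<open>u\<close> and its partner would have both
        \<open>v\<close> and \<open>z\<close> as common neighbours.\<close>
      have "?p \<notin> nbrs G z"
        using common_nbr_unique[OF p(1) uz nbrs_sym uv nbrs_sym] p(2) zv(1) by metis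
      then have yp: "y ?p = 5 / 2" using mat[OF partner_matched[OF 4(1)]] by simp
      have "nbrs G u = {v, z, ?p}"
        using split uv uz unfolding nbrs_Int_matched[OF 4(1)] by auto
      moreover have "?p \<noteq> v" "?p \<noteq> z" using p zv nbrs_irrefl by auto
      ultimately have "card (nbrs G u) = 3" "sum y (nbrs G u) = y v + y z + 5 / 2"
        using zv yp by auto
      moreover have "y v + y z = 2 * real n - 4" using zv by (simp add: y_def)
      moreover have yu: "y u = 7 / 2" using mat[OF 4(1)] 4(2) by simp
      \<comment> \<open>The inequality \<open>21 / 2 + (2 * n - 4) + 5 / 2 \<le> 7 / 2 * n\<close>
        is equivalent to \<open>n \<ge> 6\<close>.\<close>
      ultimately show ?thesis using n6 unfolding yu by simp
    next
      case 5
      let ?p = "partner v u"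
      have p: "?p \<in> nbrs G u" "?p \<in> nbrs G v" using partner_nbrs[OF 5(1)] by auto
      \<comment> \<open>The partner may be adjacent to \<open>z\<close>, so only the larger of the
        two matched values bounds it.\<close>
      have yp: "y ?p \<le> 7 / 2" using mat[OF partner_matched[OF 5(1)]] by simp
      have "u \<in> nbrs G v" using 5(1) matched_subset by blast
      then have "v \<in> nbrs G u" by (rule nbrs_sym)
      moreover have "z \<notin> nbrs G u" using 5(2) nbrs_sym[of z u] by blast
      ultimately have "nbrs G u = {v, ?p}"
        using split unfolding nbrs_Int_matched[OF 5(1)] by auto
      moreover have "?p \<noteq> v" using p nbrs_irrefl by auto
      ultimately have "card (nbrs G u) = 2" "sum y (nbrs G u) = y v + y ?p" by auto
      moreover have "y v = real n - 2 + real m / 2" by (simp add: y_def)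
      moreover have yu: "y u = 5 / 2" using mat[OF 5(1)] 5(2) by simp
      ultimately show ?thesis using n6 mn yp unfolding yu by simp
    qed
  qed
  then show ?thesis using eigenvalue_le_test_function[OF k, of y "real n"] pos by (simp add: n_def)
qed

section \<open>Graphs with a dominating vertex\<close>

text \<open>For \<open>k > 3\<close> the value at \<open>v\<close> determines an eigenvector: it is
  \<open>x v / (k - 3)\<close> on matched and \<open>x v / (k - 1)\<close> on unmatched neighbours.
  Only the equation at \<open>v\<close> remains, and clearing denominators turns it into the
  cubic.\<close>

lemma eigenvalue_dominating_iff:
  assumes v: "v \<in> pverts G" "nbrs G v = pverts G - {v}" and "k > 3"
  shows "eigenvalue (signless_laplacian G) k \<longleftrightarrow>
    k * (k - card (pverts G)) * (k - 3) = 2 * card (matched v)"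
proof -
  define n where "n = real (card (pverts G))"
  define m where "m = real (card (matched v))"
  have "card (pverts G) > 0" using v(1) by (auto simp: card_gt_0_iff)
  then have cN: "real (card (nbrs G v)) = n - 1"
    using v by (simp add: n_def card_Diff_singleton of_nat_diff)
  have "card (matched v) \<le> card (nbrs G v)" by (rule card_mono) (simp_all add: matched_subset)
  then have cU: "real (card (nbrs G v - matched v)) = n - 1 - m"
    using matched_subset by (simp add: card_Diff_subset of_nat_diff cN m_def)
  have split: "nbrs G w = insert v (nbrs G w \<inter> nbrs G v)" if "w \<in> nbrs G v" for w
  proof -
    have "nbrs G w \<subseteq> pverts G" by (auto dest: nbrs_verts(1))
    with nbrs_sym[OF that] show ?thesis unfolding v(2) by blast
  qed
  have nM: "nbrs G w = {v, partner v w}" "partner v w \<noteq> v" if "w \<in> matched v" for w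
  proof -
    show "nbrs G w = {v, partner v w}"
      using split[OF subsetD[OF matched_subset that]] unfolding nbrs_Int_matched[OF that] .
    show "partner v w \<noteq> v" using partner_nbrs[OF that] nbrs_irrefl[of v] by (metis IntD2)
  qed
  have nU: "nbrs G w = {v}" if "w \<in> nbrs G v - matched v" for w
    using split[of w] that by (simp add: matched_def)
  have V: "pverts G = insert v (nbrs G v)" using v by blast
  have eqM: "real (card (nbrs G w)) * x w + sum x (nbrs G w) = 2 * x w + (x v + x (partner v w))"
    if "w \<in> matched v" for x w
    using nM[OF that] by auto
  have eqU: "real (card (nbrs G w)) * x w + sum x (nbrs G w) = x w + x v"
    if "w \<in> nbrs G v - matched v" for x w
    using nU[OF that] by simp
  have key: "(n - 1) + (m / (k - 3) + (n - 1 - m) / (k - 1)) = k \<longleftrightarrow> k * (k - n) * (k - 3) = 2 * m"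
  proof -
    have "m / (k - 3) + (n - 1 - m) / (k - 1) = (m * (k - 1) + (n - 1 - m) * (k - 3)) / ((k - 3) * (k - 1))"
      using \<open>k > 3\<close> by (simp add: add_frac_eq)
    moreover have "\<dots> = k - (n - 1) \<longleftrightarrow> m * (k - 1) + (n - 1 - m) * (k - 3) = (k - (n - 1)) * ((k - 3) * (k - 1))"
      using \<open>k > 3\<close> by (intro divide_eq_eq[THEN trans]) simp
    moreover have "\<dots> \<longleftrightarrow> k * (k - n) * (k - 3) = 2 * m" by (auto simp: algebra_simps)
    ultimately show ?thesis by (smt (verit))
  qed
  have sumN: "sum x (nbrs G v) = m * p + (n - 1 - m) * q"
    if "\<And>w. w \<in> matched v \<Longrightarrow> x w = p" "\<And>w. w \<in> nbrs G v - matched v \<Longrightarrow> x w = q" for x p q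
  proof -
    have "sum x (nbrs G v) = sum x (nbrs G v - matched v) + sum x (matched v)"
      using matched_subset by (intro sum.subset_diff) auto
    then show ?thesis using that by (simp add: cU m_def)
  qed
  have "eigenvalue (signless_laplacian G) k \<longleftrightarrow> (n - 1) + (m / (k - 3) + (n - 1 - m) / (k - 1)) = k"
  proof
    assume "eigenvalue (signless_laplacian G) k"
    then obtain x u where u: "u \<in> pverts G" "x u \<noteq> 0"
      and eq: "\<And>w. w \<in> pverts G \<Longrightarrow> real (card (nbrs G w)) * x w + sum x (nbrs G w) = k * x w"
      using eigenvalue_iff_nbrs[OF pair_graph] by blast
    have xM: "x w = x v / (k - 3)" if w: "w \<in> matched v" for w
    proof -
      have pw: "partner v w \<in> matched v" using w by (rule partner_matched)
      have "w \<in> pverts G" "partner v w \<in> pverts G"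
        using w pw matched_subset[of v] unfolding V by blast+
      then have e: "2 * x w + (x v + x (partner v w)) = k * x w"
        "2 * x (partner v w) + (x v + x w) = k * x (partner v w)"
        using eq eqM[OF w] eqM[OF pw] partner_partner[OF w] by metis+
      \<comment> \<open>Subtracting the equations at the two ends of a matching edge shows that both
        carry the same value.\<close>
      then have "(k - 1) * (x w - x (partner v w)) = 0" by (simp add: algebra_simps)
      then have "x (partner v w) = x w" using \<open>k > 3\<close> by simp
      with e(1) have "(k - 3) * x w = x v" by (simp add: algebra_simps)
      then show ?thesis using \<open>k > 3\<close> by (simp add: eq_divide_eq mult.commute)
    qed
    have xU: "x w = x v / (k - 1)" if w: "w \<in> nbrs G v - matched v" for w
    proof -
      have "w \<in> pverts G" using w unfolding V by blast
      with eq eqU[OF w] have "x w + x v = k * x w" by metis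
      then show ?thesis using \<open>k > 3\<close> by (simp add: eq_divide_eq algebra_simps)
    qed
    \<comment> \<open>With \<open>x v = 0\<close> the two formulas would make \<open>x\<close>
      vanish everywhere.\<close>
    have "x v \<noteq> 0"
      using u xM xU V by (metis DiffI div_0 insertE)
    have "(n - 1) * x v + (m * (x v / (k - 3)) + (n - 1 - m) * (x v / (k - 1))) = k * x v"
      using eq[OF v(1)] sumN[OF xM xU] by (simp add: cN)
    then have "((n - 1) + (m / (k - 3) + (n - 1 - m) / (k - 1))) * x v = k * x v"
      by (simp add: algebra_simps)
    with \<open>x v \<noteq> 0\<close> show "(n - 1) + (m / (k - 3) + (n - 1 - m) / (k - 1)) = k" by simp
  next
    assume R: "(n - 1) + (m / (k - 3) + (n - 1 - m) / (k - 1)) = k"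
    define x where "x w = (if w = v then 1 else if w \<in> matched v then 1 / (k - 3) else 1 / (k - 1))" for w
    have xM: "x w = 1 / (k - 3)" if "w \<in> matched v" for w
      using that matched_subset[of v] nbrs_irrefl by (auto simp: x_def)
    have xU: "x w = 1 / (k - 1)" if "w \<in> nbrs G v - matched v" for w
      using that nbrs_irrefl by (auto simp: x_def)
    have xv: "x v = 1" by (simp add: x_def)
    have "real (card (nbrs G w)) * x w + sum x (nbrs G w) = k * x w" if w: "w \<in> pverts G" for w
    proof -
      consider "w = v" | "w \<in> matched v" | "w \<in> nbrs G v - matched v"
        using w unfolding V by blast
      then show ?thesis
      proof cases
        case 1
        have "sum x (nbrs G v) = m / (k - 3) + (n - 1 - m) / (k - 1)"
          using sumN[of x "1 / (k - 3)" "1 / (k - 1)", OF xM xU] by simp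
        then show ?thesis unfolding 1 cN xv using R by simp
      next
        case 2
        have "(k - 3) * (1 / (k - 3)) = 1" using \<open>k > 3\<close> by simp
        then show ?thesis
          unfolding eqM[OF 2] unfolding xM[OF 2] xM[OF partner_matched[OF 2]] xv left_diff_distrib
          by linarith
      next
        case 3
        have "(k - 1) * (1 / (k - 1)) = 1" using \<open>k > 3\<close> by simp
        then show ?thesis unfolding eqU[OF 3] unfolding xU[OF 3] xv left_diff_distrib by linarith
      qed
    qed
    then show "eigenvalue (signless_laplacian G) k"
      unfolding eigenvalue_iff_nbrs[OF pair_graph]
      by (intro exI[of _ x] conjI bexI[OF _ v(1)]) (simp_all add: xv)
  qed
  with key show ?thesis by (simp add: n_def m_def)
qed

text \<open>The cubic vanishes at \<open>n\<close> while \<open>2 * m > 0\<close>, so the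
  intermediate value theorem gives a solution beyond \<open>n \<ge> 3\<close>, where solutions are
  eigenvalues.\<close>

lemma signless_spectral_radius_dominating:
  assumes v: "v \<in> pverts G" "nbrs G v = pverts G - {v}" and M: "matched v \<noteq> {}"
    and ge: "card (pverts G) \<ge> 3"
  shows "card (pverts G) < signless_spectral_radius G"
proof -
  define n where "n = real (card (pverts G))"
  define m where "m = real (card (matched v))"
  have n: "n \<ge> 3" using ge by (simp add: n_def)
  have m: "m > 0" using M by (simp add: m_def card_gt_0_iff)
  define h where "h k = k * (k - n) * (k - 3)" for k :: real
  have "\<exists>k\<ge>n. k \<le> n + m + 3 \<and> h k = 2 * m"
  proof (rule IVT')
    show "h n \<le> 2 * m" using m by (simp add: h_def)
    \<comment> \<open>At the right end \<open>n + m + 3\<close> the three factors of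
      \<open>h\<close> are at least 1, \<open>m + 3\<close> and \<open>m + 3\<close>.\<close>
    have "2 * m \<le> (1 * (m + 3)) * (m + 3)" using m by (simp add: algebra_simps)
    also have "\<dots> \<le> ((n + m + 3) * (m + 3)) * (n + m)"
      using m n by (intro mult_mono) auto
    finally show "2 * m \<le> h (n + m + 3)" by (simp add: h_def)
    show "continuous_on {n..n + m + 3} h" unfolding h_def by (intro continuous_intros)
  qed (use m in simp)
  then obtain k where k: "k \<ge> n" "h k = 2 * m" by blast
  have "k \<noteq> n" using k(2) m by (auto simp: h_def)
  with k(1) have "k > n" by simp
  then have "eigenvalue (signless_laplacian G) k"
    using k(2) n by (subst eigenvalue_dominating_iff[OF v]) (simp_all add: h_def n_def m_def)
  from signless_spectral_radius_ge[OF this] \<open>k > n\<close> show ?thesis by (simp add: n_def)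
qed

end

section \<open>Friendship graphs and isomorphisms\<close>

text \<open>One description for both parities: \<open>Suc i div 2\<close> is the index of the
  triangle containing \<open>i > 0\<close>. For even \<open>n\<close> the pendant vertex is alone
  with its index.\<close>

lemma nbrs_friendship:
  assumes "n \<ge> 3"
  shows "nbrs (friendship n) i =
    {j. i < n \<and> j < n \<and> i \<noteq> j \<and> (i = 0 \<or> j = 0 \<or> Suc i div 2 = Suc j div 2)}"
proof -
  have tri: "(i, j) \<in> parcs (triangles k) \<longleftrightarrow>
      i \<le> 2 * k \<and> j \<le> 2 * k \<and> i \<noteq> j \<and> (i = 0 \<or> j = 0 \<or> Suc i div 2 = Suc j div 2)" (is "?L \<longleftrightarrow> ?R") for i j k
  proof
    assume ?L
    then show ?R by (auto simp: triangles_def)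
  next
    assume R: ?R
    \<comment> \<open>The triangle index is read off from an end of the arc that is not the
      center.\<close>
    define l where "l = (if i = 0 then Suc j div 2 else Suc i div 2)"
    have "l \<in> {1..k}" "i \<in> {0, 2 * l - 1, 2 * l}" "j \<in> {0, 2 * l - 1, 2 * l}"
      using R by (auto simp: l_def)
    with R show ?L by (auto simp: triangles_def)
  qed
  show ?thesis
  proof (cases "odd n")
    case True
    then have "2 * ((n - 1) div 2) = n - 1" by simp
    with True assms show ?thesis by (auto simp: nbrs_def friendship_def tri)
  next
    case False
    then have "2 * ((n - 2) div 2) = n - 2" by simp
    then have arcs: "(i, j) \<in> parcs (friendship n) \<longleftrightarrow>
      (i \<le> n - 2 \<and> j \<le> n - 2 \<and> i \<noteq> j \<and> (i = 0 \<or> j = 0 \<or> Suc i div 2 = Suc j div 2))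
      \<or> i = 0 \<and> j = n - 1 \<or> i = n - 1 \<and> j = 0" for i j
      using False by (auto simp: friendship_def tri Let_def)
    have last: "Suc l div 2 < Suc (n - 1) div 2" if "l \<le> n - 2" for l
    proof -
      have "Suc (n - 1) = n" "Suc l < n" using that assms by auto
      with False show ?thesis by presburger
    qed
    have "(i, j) \<in> parcs (friendship n) \<longleftrightarrow>
      i < n \<and> j < n \<and> i \<noteq> j \<and> (i = 0 \<or> j = 0 \<or> Suc i div 2 = Suc j div 2)" for j
    proof -
      have lt: "l < n \<longleftrightarrow> l \<le> n - 2 \<or> l = n - 1" "l \<le> n - 2 \<Longrightarrow> l \<noteq> n - 1" for l
        using assms by linarith+
      consider "i \<le> n - 2" "j \<le> n - 2" | "i = n - 1" "j \<le> n - 2" | "i \<le> n - 2" "j = n - 1"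
        | "i = n - 1" "j = n - 1" | "\<not> i < n \<or> \<not> j < n" using lt(1) by blast
      then show ?thesis
      proof cases
        case 1
        then show ?thesis unfolding arcs using lt by blast
      next
        case 2
        have "\<not> i \<le> n - 2" "i \<noteq> 0" "i \<noteq> j" "Suc i div 2 \<noteq> Suc j div 2" "i < n" "j < n"
          using 2 assms last[OF 2(2)] by auto
        with 2(1) show ?thesis unfolding arcs by blast
      next
        case 3
        have "\<not> j \<le> n - 2" "j \<noteq> 0" "i \<noteq> j" "Suc i div 2 \<noteq> Suc j div 2" "i < n" "j < n"
          using 3 assms last[OF 3(1)] by auto
        with 3(2) show ?thesis unfolding arcs by blast
      next
        case 4
        with assms show ?thesis unfolding arcs by auto
      next
        case 5
        with assms show ?thesis unfolding arcs by auto
      qed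
    qed
    then show ?thesis by (simp add: nbrs_def)
  qed
qed

lemma pverts_friendship:
  assumes "n \<ge> 3"
  shows "pverts (friendship n) = {..<n}"
proof (cases "odd n")
  case True
  then have "2 * ((n - 1) div 2) = n - 1" by simp
  then show ?thesis using True assms by (auto simp: friendship_def triangles_def)
next
  case False
  then have "2 * ((n - 2) div 2) = n - 2" by simp
  then show ?thesis using False assms by (auto simp: friendship_def triangles_def)
qed

text \<open>Noncentral vertices are adjacent only within an index class, and such a class has at
  most two elements. So an edge at the center leaves one candidate for a common neighbour, and any
  other edge leaves only the center.\<close>

lemma diamond_free_friendship:
  assumes "n \<ge> 3"
  shows "diamond_free_graph (friendship n)"
proof -
  interpret pair_graph "friendship n" using assms by (rule pair_graph_friendship)
  show ?thesis
  proof unfold_locales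
    fix u v a b
    assume "v \<in> nbrs (friendship n) u" "a \<in> nbrs (friendship n) u" "a \<in> nbrs (friendship n) v"
      "b \<in> nbrs (friendship n) u" "b \<in> nbrs (friendship n) v"
    then have *: "u \<noteq> v" "u \<noteq> a" "v \<noteq> a" "u \<noteq> b" "v \<noteq> b"
      "u = 0 \<or> v = 0 \<or> Suc u div 2 = Suc v div 2"
      "u = 0 \<or> a = 0 \<or> Suc u div 2 = Suc a div 2" "v = 0 \<or> a = 0 \<or> Suc v div 2 = Suc a div 2"
      "u = 0 \<or> b = 0 \<or> Suc u div 2 = Suc b div 2" "v = 0 \<or> b = 0 \<or> Suc v div 2 = Suc b div 2"
      unfolding nbrs_friendship[OF assms] by simp_all
    have pair: "x = y" if "Suc z div 2 = Suc x div 2" "Suc z div 2 = Suc y div 2" "z \<noteq> x" "z \<noteq> y" for x y z :: nat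
    proof -
      have "Suc w = 2 * (Suc w div 2) \<or> Suc w = Suc (2 * (Suc w div 2))" for w by presburger
      from this[of x] this[of y] this[of z] that show ?thesis by (metis Suc_inject)
    qed
    show "a = b"
    proof (cases "u = 0 \<or> v = 0")
      case True
      then show ?thesis using * pair[of v a b] pair[of u a b] by metis
    next
      case False
      then have "a = 0" "b = 0" using * pair[of u v a] pair[of u v b] by metis+
      then show ?thesis by simp
    qed
  qed
qed

text \<open>Every noncentral vertex lies in a triangle, except the pendant vertex
  \<open>n - 1\<close> for even \<open>n\<close>, which the rounding discards.\<close>

lemma card_matched_friendship:
  assumes "n \<ge> 3"
  shows "card (diamond_free_graph.matched (friendship n) 0) = 2 * ((n - 1) div 2)"
proof -
  interpret diamond_free_graph "friendship n" using assms by (rule diamond_free_friendship)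
  have "matched 0 = {1..2 * ((n - 1) div 2)}"
    unfolding set_eq_iff
  proof
    fix i
    define P where "P j \<longleftrightarrow> Suc i div 2 = Suc j div 2" for j
    define Q where "Q \<longleftrightarrow> (\<exists>j. j \<noteq> 0 \<and> j < n \<and> i \<noteq> j \<and> P j)"
    have key: "Q \<longleftrightarrow> i \<le> 2 * ((n - 1) div 2)"
      if "i \<noteq> 0" "i < n"
    proof
      assume "i \<le> 2 * ((n - 1) div 2)"
      moreover have "2 * ((n - 1) div 2) \<le> n - 1" by (rule times_div_less_eq_dividend)
      moreover have "i \<noteq> 2 * ((n - 1) div 2)" if "odd i" using that by auto
      ultimately have "Suc i < n" if "odd i" using that by linarith
      \<comment> \<open>The witness is the third vertex of the triangle: triangles pair each odd
        number with its successor.\<close>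
      then show Q
        unfolding Q_def P_def using that by (intro exI[of _ "if odd i then i + 1 else i - 1"]) (auto elim!: oddE evenE)
    next
      assume Q
      then obtain j where j: "j < n" "i \<noteq> j" "Suc i div 2 = Suc j div 2" unfolding Q_def P_def by blast
      have half: "w = 2 * (w div 2) \<or> w = Suc (2 * (w div 2))" for w :: nat by presburger
      show "i \<le> 2 * ((n - 1) div 2)"
      proof (rule ccontr)
        assume "\<not> ?thesis"
        \<comment> \<open>Now \<open>i\<close> is the pendant vertex, and the only other number with
          its index is \<open>n\<close>, which is out of range.\<close>
        then have i: "i = Suc (2 * ((n - 1) div 2))" "i = n - 1" using that half[of "n - 1"] by linarith+
        then have "Suc i div 2 = Suc ((n - 1) div 2)" by simp
        with half[of "Suc j"] j(3) have "Suc j = Suc i \<or> Suc j = Suc (Suc i)" using i(1) by auto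
        with j(1,2) i(2) show False by auto
      qed
    qed
    have "2 * ((n - 1) div 2) \<le> n - 1" by (rule times_div_less_eq_dividend)
    then have "i < n" if "i \<le> 2 * ((n - 1) div 2)" using that assms by linarith
    moreover have "i \<in> matched 0 \<longleftrightarrow> i \<noteq> 0 \<and> i < n \<and> Q"
    proof -
      have N0: "j \<in> nbrs (friendship n) 0 \<longleftrightarrow> j \<noteq> 0 \<and> j < n" for j
        using assms by (auto simp: nbrs_friendship)
      have Ni: "j \<in> nbrs (friendship n) i \<longleftrightarrow> i < n \<and> j < n \<and> i \<noteq> j \<and> (i = 0 \<or> j = 0 \<or> P j)" for j
        by (simp add: nbrs_friendship[OF assms] P_def)
      have "i \<in> matched 0 \<longleftrightarrow> i \<in> nbrs (friendship n) 0 \<and>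
          (\<exists>j. j \<in> nbrs (friendship n) i \<and> j \<in> nbrs (friendship n) 0)"
        unfolding matched_def by blast
      then show ?thesis unfolding N0 Ni Q_def by (cases "i = 0") (simp, metis)
    qed
    moreover have "i \<in> {1..2 * ((n - 1) div 2)} \<longleftrightarrow> i \<noteq> 0 \<and> i \<le> 2 * ((n - 1) div 2)"
      by (simp add: Suc_le_eq)
    ultimately show "i \<in> matched 0 \<longleftrightarrow> i \<in> {1..2 * ((n - 1) div 2)}" using key by blast
  qed
  then show ?thesis by simp
qed

section \<open>Isomorphisms as adjacency-preserving bijections, and invariance of the
  spectrum\<close>

lemma digraph_iso_iff_bij:
  assumes "pair_graph G" "pair_graph H"
  shows "digraph_iso (with_proj G) (with_proj H) \<longleftrightarrow>
    (\<exists>f. bij_betw f (pverts G) (pverts H) \<and>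
      (\<forall>u\<in>pverts G. \<forall>v\<in>pverts G. v \<in> nbrs G u \<longleftrightarrow> f v \<in> nbrs H (f u)))" (is "?L \<longleftrightarrow> ?R")
proof
  interpret G: pair_graph G by fact
  interpret H: pair_graph H by fact
  {
    assume ?L
    then obtain h where h: "G.digraph_isomorphism h" and H: "with_proj H = app_iso h (with_proj G)"
      by (auto simp: digraph_iso_def)
    let ?f = "iso_verts h"
    \<comment> \<open>Tail and head are the projections on both sides, which forces the arc map to
      act on each end by \<open>iso_verts h\<close>.\<close>
    from H have V: "pverts H = ?f ` pverts G" and A: "parcs H = iso_arcs h ` parcs G"
      and T: "fst = iso_tail h" "snd = iso_head h"
      by (auto simp: app_iso_def with_proj_def)
    have inj: "inj_on ?f (pverts G)" using h by (simp add: G.digraph_isomorphism_def)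
    have arc: "iso_arcs h (u, v) = (?f u, ?f v)" if "(u, v) \<in> parcs G" for u v
      using h that by (auto simp: G.digraph_isomorphism_def T[symmetric] prod_eq_iff)
    have "v \<in> nbrs G u \<longleftrightarrow> ?f v \<in> nbrs H (?f u)" if uv: "u \<in> pverts G" "v \<in> pverts G" for u v
    proof
      assume "v \<in> nbrs G u"
      then show "?f v \<in> nbrs H (?f u)" using arc[of u v] by (force simp: nbrs_def A)
    next
      assume "?f v \<in> nbrs H (?f u)"
      then obtain a b where ab: "(a, b) \<in> parcs G" "iso_arcs h (a, b) = (?f u, ?f v)"
        by (force simp: nbrs_def A)
      then have "?f a = ?f u" "?f b = ?f v" using arc by auto
      moreover have "a \<in> pverts G" "b \<in> pverts G" using ab(1) by (auto dest: G.in_arcsD1 G.in_arcsD2)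
      ultimately have "a = u" "b = v" using inj uv by (auto dest: inj_onD)
      with ab(1) show "v \<in> nbrs G u" by (simp add: nbrs_def)
    qed
    then show ?R using inj V by (intro exI[of _ ?f]) (simp add: bij_betw_def)
  next
    assume ?R
    then obtain f where inj: "inj_on f (pverts G)" and V: "pverts H = f ` pverts G"
      and f: "\<And>u v. u \<in> pverts G \<Longrightarrow> v \<in> pverts G \<Longrightarrow> v \<in> nbrs G u \<longleftrightarrow> f v \<in> nbrs H (f u)"
      by (auto simp: bij_betw_def)
    let ?h = "\<lparr> iso_verts = f, iso_arcs = map_prod f f, iso_head = snd, iso_tail = fst \<rparr>"
    have sub: "parcs G \<subseteq> pverts G \<times> pverts G" by (auto dest: G.in_arcsD1 G.in_arcsD2)
    have "inj_on (map_prod f f) (parcs G)"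
      by (rule inj_on_subset[OF map_prod_inj_on[OF inj inj] sub])
    then have "G.digraph_isomorphism ?h"
      using inj G.wf_digraph_axioms by (auto simp: G.digraph_isomorphism_def)
    moreover have "parcs H = map_prod f f ` parcs G"
    proof (intro subset_antisym subrelI)
      fix a b assume ab: "(a, b) \<in> parcs H"
      then obtain u v where "u \<in> pverts G" "v \<in> pverts G" "a = f u" "b = f v"
        using V by (blast dest: H.in_arcsD1 H.in_arcsD2)
      with f[of u v] ab show "(a, b) \<in> map_prod f f ` parcs G" by (auto simp: nbrs_def)
    next
      fix a b assume "(a, b) \<in> map_prod f f ` parcs G"
      then obtain u v where "(u, v) \<in> parcs G" "a = f u" "b = f v" by auto
      with f[of u v] sub show "(a, b) \<in> parcs H" by (auto simp: nbrs_def)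
    qed
    ultimately show ?L
      unfolding digraph_iso_def using V by (intro exI[of _ ?h]) (simp add: app_iso_def with_proj_def)
  }
qed

text \<open>An eigenvector of \<open>H\<close> composed with the vertex bijection is one of
  \<open>G\<close>, because neighbourhoods correspond.\<close>

lemma eigenvalue_digraph_iso:
  assumes G: "pair_graph G" and H: "pair_graph H" and iso: "digraph_iso (with_proj G) (with_proj H)"
    and k: "eigenvalue (signless_laplacian H) k"
  shows "eigenvalue (signless_laplacian G) k"
proof -
  interpret G: pair_graph G by fact
  interpret H: pair_graph H by fact
  obtain f where inj: "inj_on f (pverts G)" and V: "pverts H = f ` pverts G"
    and f: "\<And>u v. u \<in> pverts G \<Longrightarrow> v \<in> pverts G \<Longrightarrow> v \<in> nbrs G u \<longleftrightarrow> f v \<in> nbrs H (f u)"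
    using iso unfolding digraph_iso_iff_bij[OF G H] by (auto simp: bij_betw_def)
  have nb: "nbrs H (f u) = f ` nbrs G u" "inj_on f (nbrs G u)" if "u \<in> pverts G" for u
  proof -
    show "nbrs H (f u) = f ` nbrs G u"
    proof (intro subset_antisym subsetI)
      fix b assume b: "b \<in> nbrs H (f u)"
      then obtain v where "v \<in> pverts G" "b = f v" using H.nbrs_verts(1) V by blast
      with b f[OF that] show "b \<in> f ` nbrs G u" by blast
    qed (use f[OF that] G.nbrs_verts(1) in blast)
    show "inj_on f (nbrs G u)" by (rule inj_on_subset[OF inj]) (use G.nbrs_verts(1) in blast)
  qed
  obtain x where x: "\<exists>v\<in>pverts H. x v \<noteq> 0"
    "\<forall>v\<in>pverts H. real (card (nbrs H v)) * x v + sum x (nbrs H v) = k * x v"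
    using k unfolding eigenvalue_iff_nbrs[OF H] by blast
  show ?thesis
    unfolding eigenvalue_iff_nbrs[OF G]
  proof (intro exI[of _ "x \<circ> f"] conjI ballI)
    show "\<exists>v\<in>pverts G. (x \<circ> f) v \<noteq> 0" using x(1) V by auto
    fix u assume u: "u \<in> pverts G"
    then have "f u \<in> pverts H" using V by blast
    with x(2) have "real (card (nbrs H (f u))) * x (f u) + sum x (nbrs H (f u)) = k * x (f u)" by blast
    then show "real (card (nbrs G u)) * (x \<circ> f) u + sum (x \<circ> f) (nbrs G u) = k * (x \<circ> f) u"
      using nb[OF u] by (simp add: card_image sum.reindex)
  qed
qed

section \<open>Involutions on finite sets\<close>

lemma even_card_involution:
  assumes "finite M" "\<And>w. w \<in> M \<Longrightarrow> f w \<in> M" "\<And>w. w \<in> M \<Longrightarrow> f (f w) = w" "\<And>w. w \<in> M \<Longrightarrow> f w \<noteq> w"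
  shows "even (card M)"
  using assms
proof (induction "card M" arbitrary: M rule: less_induct)
  case less
  show ?case
  proof (cases "M = {}")
    case False
    then obtain w where w: "w \<in> M" by blast
    define M' where "M' = M - {w, f w}"
    have M: "M = insert w (insert (f w) M')" "w \<notin> insert (f w) M'" "f w \<notin> M'"
      using w less.prems(2) less.prems(4)[OF w] by (auto simp: M'_def)
    have "finite M'" using less.prems(1) by (simp add: M'_def)
    then have c: "card M = Suc (Suc (card M'))" using M by (metis card_insert_disjoint finite_insert)
    have "even (card M')"
    proof (rule less.hyps)
      show "f u \<in> M'" if "u \<in> M'" for u
        using that less.prems(2,3) w unfolding M'_def by (metis Diff_iff insert_iff empty_iff)
    qed (use c \<open>finite M'\<close> less.prems in \<open>auto simp: M'_def\<close>)
    then show ?thesis by (simp add: c)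
  qed simp
qed

text \<open>The 2-cycles occupy the positions 1 and 2, 3 and 4, and so on, with a possible fixed
  point last; this is the labelling used by \<open>friendship\<close>. The induction strips one
  2-cycle and shifts the rest by two.\<close>

lemma involution_enumeration:
  assumes "finite W" "\<And>w. w \<in> W \<Longrightarrow> f w \<in> W" "\<And>w. w \<in> W \<Longrightarrow> f (f w) = w" "card {w \<in> W. f w = w} \<le> 1"
  shows "\<exists>e. bij_betw e {1..card W} W \<and>
    (\<forall>i\<in>{1..card W}. \<forall>j\<in>{1..card W}. i \<noteq> j \<longrightarrow> (f (e i) = e j \<longleftrightarrow> Suc i div 2 = Suc j div 2))"
  using assms
proof (induction "card W" arbitrary: W rule: less_induct)
  case less
  show ?case
  proof (cases "\<exists>w\<in>W. f w \<noteq> w")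
    case False
    \<comment> \<open>With every point fixed, \<open>W\<close> has at most one element and the
      adjacency condition is vacuous.\<close>
    then have "{w \<in> W. f w = w} = W" by blast
    with less.prems have "card W \<le> 1" by simp
    moreover obtain e where "bij_betw e {1..card W} W"
      using ex_bij_betw_nat_finite_1[OF \<open>finite W\<close>] by blast
    ultimately show ?thesis by (intro exI[of _ e]) auto
  next
    case True
    then obtain w where w: "w \<in> W" "f w \<noteq> w" by blast
    define W' where "W' = W - {w, f w}"
    have W: "W = insert w (insert (f w) W')" "w \<notin> insert (f w) W'" "f w \<notin> W'"
      using w less.prems(2) by (auto simp: W'_def)
    have fin: "finite W'" using less.prems(1) by (simp add: W'_def)
    then have c: "card W = Suc (Suc (card W'))" using W by (metis card_insert_disjoint finite_insert)
    have clos: "f u \<in> W'" if "u \<in> W'" for u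
      using that less.prems(2,3) w unfolding W'_def by (metis Diff_iff insert_iff empty_iff)
    have "\<exists>e. bij_betw e {1..card W'} W' \<and>
      (\<forall>i\<in>{1..card W'}. \<forall>j\<in>{1..card W'}. i \<noteq> j \<longrightarrow> (f (e i) = e j \<longleftrightarrow> Suc i div 2 = Suc j div 2))"
    proof (rule less.hyps)
      have "card {w \<in> W'. f w = w} \<le> card {w \<in> W. f w = w}"
        using less.prems(1) by (intro card_mono) (auto simp: W'_def)
      then show "card {w \<in> W'. f w = w} \<le> 1" using less.prems(4) by simp
    qed (use c fin clos less.prems in \<open>auto simp: W'_def\<close>)
    then obtain e where e: "bij_betw e {1..card W'} W'"
      "\<And>i j. i \<in> {1..card W'} \<Longrightarrow> j \<in> {1..card W'} \<Longrightarrow> i \<noteq> j \<Longrightarrow> f (e i) = e j \<longleftrightarrow> Suc i div 2 = Suc j div 2"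
      by blast
    define e' where "e' i = (if i = 1 then w else if i = 2 then f w else e (i - 2))" for i
    have e'W: "e' i \<in> W'" if "i \<in> {3..card W}" for i
    proof -
      have "i - 2 \<in> {1..card W'}" using that c by auto
      with bij_betwE[OF e(1)] have "e (i - 2) \<in> W'" by blast
      then show ?thesis using that by (simp add: e'_def)
    qed
    have shift: "bij_betw (\<lambda>i. i - 2) {3..card W} {1..card W'}"
      by (rule bij_betwI[of _ _ _ "\<lambda>i. i + 2"]) (use c in auto)
    have b3: "bij_betw e' {3..card W} W'"
      using bij_betw_trans[OF shift e(1)] by (rule bij_betw_cong[THEN iffD1, rotated]) (auto simp: e'_def)
    have "bij_betw e' ({1} \<union> ({2} \<union> {3..card W})) ({w} \<union> ({f w} \<union> W'))"
      by (intro bij_betw_combine b3) (use W(2,3) in \<open>auto simp: bij_betw_def e'_def\<close>)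
    moreover have "{1} \<union> ({2} \<union> {3..card W}) = {1..card W}" using c by auto
    moreover have "{w} \<union> ({f w} \<union> W') = W" using W(1) by blast
    ultimately have bij: "bij_betw e' {1..card W} W" by simp
    have adj: "f (e' i) = e' j \<longleftrightarrow> Suc i div 2 = Suc j div 2"
      if ij: "i \<in> {1..card W}" "j \<in> {1..card W}" "i \<noteq> j" for i j
    proof -
      consider "i \<le> 2" "j \<le> 2" | "i \<le> 2" "j \<ge> 3" | "i \<ge> 3" "j \<le> 2" | "i \<ge> 3" "j \<ge> 3" by linarith
      then show ?thesis
      proof cases
        case 1
        with ij have "i = 1 \<and> j = 2 \<or> i = 2 \<and> j = 1" by auto
        then show ?thesis using less.prems(3) w by (auto simp: e'_def)
      next
        case 2
        with ij have "e' j \<in> W'" "i = 1 \<or> i = 2" using e'W by auto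
        moreover have "f (e' i) \<in> {w, f w}"
          using \<open>i = 1 \<or> i = 2\<close> less.prems(3)[OF w(1)] by (auto simp: e'_def)
        ultimately have "f (e' i) \<noteq> e' j" using W(2,3) by auto
        moreover have "Suc i div 2 \<noteq> Suc j div 2" using 2 by presburger
        ultimately show ?thesis by simp
      next
        case 3
        with ij have "f (e' i) \<in> W'" "j = 1 \<or> j = 2" using e'W clos by auto
        moreover have "e' j \<in> {w, f w}" using \<open>j = 1 \<or> j = 2\<close> by (auto simp: e'_def)
        ultimately have "f (e' i) \<noteq> e' j" using W(2,3) by auto
        moreover have "Suc i div 2 \<noteq> Suc j div 2" using 3 by presburger
        ultimately show ?thesis by simp
      next
        case 4
        then have "i - 2 \<in> {1..card W'}" "j - 2 \<in> {1..card W'}" "i - 2 \<noteq> j - 2"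
          using ij c by auto
        then have "f (e (i - 2)) = e (j - 2) \<longleftrightarrow> Suc (i - 2) div 2 = Suc (j - 2) div 2" by (rule e(2))
        moreover have "e' i = e (i - 2)" "e' j = e (j - 2)" using 4 by (auto simp: e'_def)
        \<comment> \<open>A shift by two raises every index by exactly one, so equality of indices
          is preserved.\<close>
        moreover have "Suc l div 2 = Suc (Suc (l - 2) div 2)" if "l \<ge> 3" for l
        proof -
          have eq: "Suc l = 2 + Suc (l - 2)" using that by simp
          have "(2 + a) div 2 = Suc (a div 2)" for a :: nat by simp
          then show ?thesis by (subst eq)
        qed
        ultimately show ?thesis using 4 by simp
      qed
    qed
    show ?thesis by (intro exI[of _ e'] conjI ballI impI bij adj)
  qed
qed

section \<open>Recognising the friendship graph from a maximal matching\<close>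

context diamond_free_graph
begin

lemma even_card_matched: "even (card (matched v))"
  by (rule even_card_involution[of _ "partner v"]) (simp_all add: partner_matched partner_partner partner_neq)

text \<open>Extended by the identity on unmatched vertices, \<open>partner v\<close> is an
  involution describing adjacency among the neighbours of \<open>v\<close>. Enumerating them along
  it and sending the center 0 to \<open>v\<close> reproduces the adjacency of
  \<open>friendship n\<close>.\<close>

lemma digraph_iso_friendship:
  assumes v: "v \<in> pverts G" "nbrs G v = pverts G - {v}" and n: "n = card (pverts G)" "n \<ge> 3"
    and m: "card (matched v) = 2 * ((n - 1) div 2)"
  shows "digraph_iso (with_proj G) (with_proj (friendship n))"
proof -
  define f where "f w = (if w \<in> matched v then partner v w else w)" for w
  let ?W = "nbrs G v"
  have cW: "card ?W = n - 1" using v n by (simp add: card_Diff_singleton)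
  \<comment> \<open>The unmatched neighbours number \<open>(n - 1) mod 2\<close>.\<close>
  have fix1: "card {w \<in> ?W. f w = w} \<le> 1"
  proof -
    have "{w \<in> ?W. f w = w} = ?W - matched v" using partner_neq by (auto simp: f_def)
    then have "card {w \<in> ?W. f w = w} = (n - 1) - 2 * ((n - 1) div 2)"
      using matched_subset by (simp add: card_Diff_subset cW m)
    then show ?thesis by (simp add: minus_mult_div_eq_mod)
  qed
  have fW: "f w \<in> ?W" "f (f w) = w" if "w \<in> ?W" for w
    using that partner_nbrs partner_matched partner_partner by (auto simp: f_def)
  obtain e where e: "bij_betw e {1..n - 1} ?W"
    "\<And>i j. i \<in> {1..n - 1} \<Longrightarrow> j \<in> {1..n - 1} \<Longrightarrow> i \<noteq> j \<Longrightarrow> f (e i) = e j \<longleftrightarrow> Suc i div 2 = Suc j div 2"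
    using involution_enumeration[OF finite_nbrs fW fix1] cW by auto
  have adj: "u \<in> nbrs G w \<longleftrightarrow> f w = u" if "w \<in> ?W" "u \<in> ?W" "u \<noteq> w" for w u
  proof (cases "w \<in> matched v")
    case True
    have "u \<in> nbrs G w \<longleftrightarrow> u \<in> nbrs G w \<inter> nbrs G v" using that by simp
    then show ?thesis using True by (auto simp: nbrs_Int_matched f_def)
  next
    case False
    then show ?thesis using that by (auto simp: f_def matched_def)
  qed
  define g where "g i = (if i = 0 then v else e i)" for i
  have eW: "e i \<in> ?W" if "i \<in> {1..n - 1}" for i using e(1) that by (rule bij_betwE[THEN bspec])
  have dom: "{..<n} = insert 0 {1..n - 1}" using n by auto
  have V: "pverts G = insert v ?W" using v by blast
  have "bij_betw g {1..n - 1} ?W"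
    using e(1) by (rule bij_betw_cong[THEN iffD1, rotated]) (auto simp: g_def)
  moreover have "bij_betw g {0} {v}" by (simp add: bij_betw_def g_def)
  ultimately have "bij_betw g ({0} \<union> {1..n - 1}) ({v} \<union> ?W)"
    using nbrs_irrefl[of v] by (intro bij_betw_combine) auto
  then have bij: "bij_betw g {..<n} (pverts G)" unfolding dom V by simp
  have gadj: "g j \<in> nbrs G (g i) \<longleftrightarrow> j \<in> nbrs (friendship n) i" if ij: "i < n" "j < n" for i j
  proof -
    consider "i = j" | "i = 0" "j \<in> {1..n - 1}" | "j = 0" "i \<in> {1..n - 1}"
      | "i \<noteq> j" "i \<in> {1..n - 1}" "j \<in> {1..n - 1}" using ij dom by (metis insertE lessThan_iff)
    then show ?thesis
    proof cases
      case 1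
      then show ?thesis using nbrs_irrefl by (simp add: nbrs_friendship[OF n(2)])
    next
      case 2
      then show ?thesis using eW[of j] ij by (auto simp: nbrs_friendship[OF n(2)] g_def)
    next
      case 3
      then show ?thesis using eW[of i] ij nbrs_sym by (auto simp: nbrs_friendship[OF n(2)] g_def)
    next
      case 4
      have "e i \<noteq> e j" using 4 e(1) by (auto simp: bij_betw_def dest: inj_onD)
      then have "e j \<in> nbrs G (e i) \<longleftrightarrow> Suc i div 2 = Suc j div 2"
        using adj[of "e i" "e j"] eW 4 e(2) by auto
      then show ?thesis using 4 ij by (auto simp: nbrs_friendship[OF n(2)] g_def)
    qed
  qed
  let ?h = "the_inv_into {..<n} g"
  have h: "bij_betw ?h (pverts G) {..<n}" using bij by (rule bij_betw_the_inv_into)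
  have gh: "g (?h u) = u" if "u \<in> pverts G" for u
    using bij that by (rule f_the_inv_into_f_bij_betw)
  have hn: "?h u < n" if "u \<in> pverts G" for u using bij_betwE[OF h] that by auto
  show ?thesis
    unfolding digraph_iso_iff_bij[OF pair_graph pair_graph_friendship[OF n(2)]] pverts_friendship[OF n(2)]
  proof (intro exI[of _ ?h] conjI ballI h)
    fix u w assume uw: "u \<in> pverts G" "w \<in> pverts G"
    show "w \<in> nbrs G u \<longleftrightarrow> ?h w \<in> nbrs (friendship n) (?h u)"
      using gadj[OF hn[OF uw(1)] hn[OF uw(2)]] uw by (simp add: gh)
  qed
qed

end

section \<open>Comparison of the two spectral radii\<close>

theorem theorem1p2:
  fixes G :: "'a pair_pre_digraph" and n :: nat
  assumes "pair_graph G"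
    and "card (pverts G) = n"
    and "n \<ge> 6"
    and "theta_free 1 2 2 G"
  shows "signless_spectral_radius G \<le> signless_spectral_radius (friendship n) \<and>
    (signless_spectral_radius G = signless_spectral_radius (friendship n) \<longleftrightarrow>
       digraph_iso (with_proj G) (with_proj (friendship n)))"
proof -
  interpret G: diamond_free_graph G using assms(1,4) by (rule diamond_free_graphI)
  have n3: "n \<ge> 3" using assms(3) by simp
  let ?F = "friendship n"
  interpret F: diamond_free_graph ?F using n3 by (rule diamond_free_friendship)
  let ?q = "signless_spectral_radius G" and ?r = "signless_spectral_radius ?F"
  define m0 where "m0 = 2 * ((n - 1) div 2)"
  have cF: "card (pverts ?F) = n" using n3 by (rule card_pverts_friendship)
  have F0: "0 \<in> pverts ?F" "nbrs ?F 0 = pverts ?F - {0}"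
    using n3 by (auto simp: pverts_friendship nbrs_friendship)
  have mF: "card (F.matched 0) = m0" unfolding m0_def using n3 by (rule card_matched_friendship)
  have "m0 > 0" using assms(3) by (simp add: m0_def)
  then have "F.matched 0 \<noteq> {}" using mF by auto
  then have r: "real n < ?r"
    using F.signless_spectral_radius_dominating[OF F0] cF n3 by simp
  have "eigenvalue (signless_laplacian ?F) ?r"
    using F0(1) by (intro F.eigenvalue_signless_spectral_radius) auto
  then have rF: "?r * (?r - n) * (?r - 3) = 2 * m0"
    using F.eigenvalue_dominating_iff[OF F0, of ?r] r n3 cF mF by simp
  have "pverts G \<noteq> {}" using assms(2,3) by auto
  then have q: "eigenvalue (signless_laplacian G) ?q" by (rule G.eigenvalue_signless_spectral_radius)
  \<comment> \<open>This half of the equality suffices, as \<open>?q \<le> ?r\<close> is shown for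
    every \<open>G\<close>.\<close>
  have ge: "?r \<le> ?q" if "digraph_iso (with_proj G) (with_proj ?F)"
    by (rule G.signless_spectral_radius_ge)
      (rule eigenvalue_digraph_iso[OF assms(1) F.pair_graph that \<open>eigenvalue _ ?r\<close>])
  show ?thesis
  proof (cases "?q \<le> n")
    case True
    \<comment> \<open>Here \<open>?q \<le> n < ?r\<close>, so the inequality is strict and
      \<open>ge\<close> rules out an isomorphism.\<close>
    with r ge show ?thesis by auto
  next
    case False
    then have qn: "real n < ?q" by simp
    have "\<exists>v\<in>pverts G. n < card (nbrs G v) + 3"
      using G.eigenvalue_le_small_degree[OF q] qn assms(2) by (metis leD linorder_le_less_linear)
    then obtain v where v: "v \<in> pverts G" "n < card (nbrs G v) + 3" by blast
    have "card (nbrs G v) + 2 \<noteq> n"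
      using G.eigenvalue_le_degree_minus_2[OF q v(1)] qn assms(2,3) by auto
    with v G.card_nbrs_less[OF v(1)] assms(2) have "card (nbrs G v) = n - 1" by simp
    then have Nv: "nbrs G v = pverts G - {v}"
      using v(1) assms(2) G.nbrs_verts(1) G.nbrs_irrefl by (intro card_subset_eq) auto
    define m where "m = card (G.matched v)"
    have qG: "?q * (?q - n) * (?q - 3) = 2 * m"
      using G.eigenvalue_dominating_iff[OF v(1) Nv, of ?q] q qn n3 assms(2) by (simp add: m_def)
    have "m \<le> n - 1"
      unfolding m_def \<open>card (nbrs G v) = n - 1\<close>[symmetric] by (rule card_mono) (simp_all add: G.matched_subset)
    moreover have "even m" unfolding m_def by (rule G.even_card_matched)
    \<comment> \<open>\<open>m0\<close> is the largest even number not exceeding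
      \<open>n - 1\<close>.\<close>
    ultimately have "m \<le> m0" unfolding m0_def by (auto elim!: evenE)
    have mono: "a * (a - n) * (a - 3) < b * (b - n) * (b - 3)" if "real n < a" "a < b" for a b :: real
      using that n3 by (intro mult_strict_mono mult_nonneg_nonneg mult_pos_pos) auto
    \<comment> \<open>If \<open>?r < ?q\<close>, strict growth of the cubic beyond \<open>n\<close>
      would give \<open>m0 < m\<close>.\<close>
    have "?q \<le> ?r"
      using mono[OF r, of ?q] qG rF \<open>m \<le> m0\<close> by fastforce
    moreover have "digraph_iso (with_proj G) (with_proj ?F)" if "?q = ?r"
    proof -
      have "m = m0" using qG rF that by simp
      then show ?thesis
        using G.digraph_iso_friendship[OF v(1) Nv assms(2)[symmetric] n3] by (simp add: m_def m0_def)
    qed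
    ultimately show ?thesis using ge by auto
  qed
qed

end
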